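(* Let $\mathfrak{U}$ and $\mathfrak{V}$ be universes with $\emptyset\neq\mathfrak{U}\in\mathfrak{V}$. Let $C$ and $D$ be essentially $\mathfrak{U}$-small categories, and let $f: C\to D$ be a functor. Consider the composite functor $$y_D^\wedge\circ f^{\wedge\wedge}\circ y_{C^\wedge}:\; C^{\wedge_{\mathfrak U}}\xrightarrow{\;y_{C^\wedge}\;} (C^{\wedge_{\mathfrak U}})^{\wedge_{\mathfrak V}}\xrightarrow{\;f^{\wedge\wedge}\;}(D^{\wedge_{\mathfrak U}})^{\wedge_{\mathfrak V}}\xrightarrow{\;y_D^\wedge\;} D^{\wedge_{\mathfrak V}},$$ which sends $v\in C^{\wedge_{\mathfrak U}}$ to the presheaf $d\mapsto \mathrm{Hom}_{C^{\wedge_{\mathfrak U}}}\big(\mathrm{Hom}_D(f(-),d),\,v\big)$ on $D$. This composite factors through the full inclusion $D^{\wedge_{\mathfrak U}}\subseteq D^{\wedge_{\mathfrak V}}$, giving a functor $\phi: C^{\wedge_{\mathfrak U}}\to D^{\wedge_{\mathfrak U}}$, and $\phi$ is right adjoint to $f^\wedge: D^{\wedge_{\mathfrak U}}\to C^{\wedge_{\mathfrak U}}$, i.e. $f^\wedge\dashv\phi$. Moreover, the following formulas give well-defined natural transformations which are the unit and the counit of this adjunction. (1) The unit $\varepsilon: 1_{D^{\wedge_{\mathfrak U}}}\to\phi\circ f^\wedge$: for $u\in D^{\wedge_{\mathfrak U}}$ and $d\in D$, the map $$\varepsilon_{u,d}: u(d)\to \mathrm{Hom}_{C^{\wedge_{\mathfrak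 U}}}\big(\mathrm{Hom}_D(f(-),d),\,u\circ f^{o}\big)$$ sends $x\in u(d)$ to the natural transformation whose component at $c\in C$ is the map $\mathrm{Hom}_D(f(c),d)\to u(f(c))$, $a\mapsto u(a)(x)$. (2) The counit $\eta: f^\wedge\circ\phi\to 1_{C^{\wedge_{\mathfrak U}}}$: for $v\in C^{\wedge_{\mathfrak U}}$ and $c\in C$, the map $$\eta_{v,c}:\mathrm{Hom}_{C^{\wedge_{\mathfrak U}}}\big(\mathrm{Hom}_D(f(-),f(c)),\,v\big)\to v(c)$$ sends $\xi$ to $\xi_c(1_{f(c)})$.
   Context: A universe is a set $\mathfrak{U}$ such that: (U1) $x\in y\in\mathfrak U$ implies $x\in\mathfrak U$; (U2) $x,y\in\mathfrak U$ implies $\{x,y\}\in\mathfrak U$; (U3) $x\in\mathfrak U$ implies that the power set of $x$ is in $\mathfrak U$; (U4) if $I\in\mathfrak U$ and $x_i\in\mathfrak U$ for all $i\in I$, then $\bigcup_{i\in I}x_i\in\mathfrak U$. It is assumed that every set is an element of some universe. A set is $\mathfrak U$-small if it is in bijection with an element of $\mathfrak U$; $(\mathrm{Set}_{\mathfrak U})$ is the category of $\mathfrak U$-small sets. A category is $\mathfrak U$-small if its set of morphisms is $\mathfrak U$-small, and essentially $\mathfrak U$-small if it is equivalent to a $\mathfrak U$-small category. Likewise for $\mathfrak V$. For a category $C$, $C^o$ is the opposite category, and $f^o: C^o\to D^o$ is the opposite of a functor $f:C\to D$. The category of presheaves $C^{\wedge_{\mathfrak U}}$ is the category of functors $C^o\to(\mathrm{Set}_{\mathfrak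 U})$. If $C$ is essentially $\mathfrak U$-small, then $C^{\wedge_{\mathfrak U}}$ is essentially $\mathfrak V$-small, so that $(C^{\wedge_{\mathfrak U}})^{\wedge_{\mathfrak V}}$, the category of functors $(C^{\wedge_{\mathfrak U}})^o\to(\mathrm{Set}_{\mathfrak V})$, can be formed. The Yoneda embedding of $C$ is $y_C: x\mapsto\mathrm{Hom}_C(-,x)$. Here $y_{C^\wedge}: C^{\wedge_{\mathfrak U}}\to(C^{\wedge_{\mathfrak U}})^{\wedge_{\mathfrak V}}$ is the Yoneda embedding of $C^{\wedge_{\mathfrak U}}$, and $y_D: D\to D^{\wedge_{\mathfrak U}}$ is that of $D$. For a functor $g: A\to B$, the functor $g^\wedge$ from presheaves on $B$ to presheaves on $A$ (with values in the same category of small sets) is precomposition with $g^o$: $u\mapsto u\circ g^o$, $\beta\mapsto\beta\circ g^o$. Thus $f^\wedge: D^{\wedge_{\mathfrak U}}\to C^{\wedge_{\mathfrak U}}$; $f^{\wedge\wedge}=(f^\wedge)^\wedge:(C^{\wedge_{\mathfrak U}})^{\wedge_{\mathfrak V}}\to(D^{\wedge_{\mathfrak U}})^{\wedge_{\mathfrak V}}$; and $y_D^\wedge=(y_D)^\wedge:(D^{\wedge_{\mathfrak U}})^{\wedge_{\mathfrak V}}\to D^{\wedge_{\mathfrak V}}$. *)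

theory Defs
  imports "HOL-Library.FuncSet"
begin

section \<open>Ambient set theory\<close>

text \<open>
  The statement lives in a set theory in which every set belongs to a universe.  A type of class
  \<open>zf_sets\<close> is a model of ZFC (choice is inherited from HOL): its elements are the sets, \<open>elts x\<close> is
  the collection of members of the set \<open>x\<close>, and HOL sets over the type are the classes.
  Replacement is stated for arbitrary HOL functions; separation follows from it.
\<close>

class zf_sets =
  fixes elts :: "'a \<Rightarrow> 'a set"
  assumes extensionality: "elts x = elts y \<Longrightarrow> x = y"
    and foundation: "wf {(x, y). x \<in> elts y}"
    and pairing: "\<exists>z. elts z = {x, y}"
    and union: "\<exists>z. elts z = (\<Union>y\<in>elts x. elts y)"
    and powerset: "\<exists>z. elts z = {y. elts y \<subseteq> elts x}"
    and replacement: "\<exists>z. elts z = h ` elts x"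
    and infinity: "\<exists>w. (\<exists>e\<in>elts w. elts e = {})
                     \<and> (\<forall>x\<in>elts w. \<exists>y\<in>elts w. elts y = insert x (elts x))"

definition is_set :: "'s::zf_sets set \<Rightarrow> bool" where
  "is_set A \<longleftrightarrow> (\<exists>x. elts x = A)"

text \<open>\<open>vset A\<close> is meaningful only if \<open>is_set A\<close>.\<close>

definition vset :: "'s::zf_sets set \<Rightarrow> 's" where
  "vset A = (THE x. elts x = A)"

definition universe :: "'s::zf_sets \<Rightarrow> bool" where
  "universe U \<longleftrightarrow>
     (\<forall>x y. x \<in> elts y \<longrightarrow> y \<in> elts U \<longrightarrow> x \<in> elts U) \<and>
     (\<forall>x\<in>elts U. \<forall>y\<in>elts U. vset {x, y} \<in> elts U) \<and>
     (\<forall>x\<in>elts U. vset {y. elts y \<subseteq> elts x} \<in> elts U) \<and>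
     (\<forall>I\<in>elts U. \<forall>X. (\<forall>i\<in>elts I. X i \<in> elts U) \<longrightarrow> vset (\<Union>i\<in>elts I. elts (X i)) \<in> elts U)"

class sets_with_universes = zf_sets +
  assumes in_universe: "\<exists>U. universe U \<and> x \<in> elts U"

definition small :: "'s::zf_sets \<Rightarrow> 'a set \<Rightarrow> bool" where
  "small U A \<longleftrightarrow> (\<exists>x\<in>elts U. \<exists>b. bij_betw b A (elts x))"

text \<open>Functions as sets of Kuratowski pairs, and their application.\<close>

definition vpair :: "'s::zf_sets \<Rightarrow> 's \<Rightarrow> 's" where
  "vpair x y = vset {vset {x}, vset {x, y}}"

definition vfun :: "'s::zf_sets set \<Rightarrow> ('s \<Rightarrow> 's) \<Rightarrow> 's" where
  "vfun A h = vset ((\<lambda>x. vpair x (h x)) ` A)"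

definition vapp :: "'s::zf_sets \<Rightarrow> 's \<Rightarrow> 's" where
  "vapp g x = (THE y. vpair x y \<in> elts g)"


section \<open>Categories, functors, natural transformations\<close>

text \<open>
  A category is given by its objects, its hom-sets and their compositions; hom-sets for different
  pairs of objects need not be disjoint, so the set of morphisms is their disjoint sum.
  \<open>Cmp A x y z g f\<close> is the composite \<open>g \<circ> f\<close> of \<open>f : x \<rightarrow> y\<close> and \<open>g : y \<rightarrow> z\<close>.
\<close>

record ('o, 'm) cat =
  Ob  :: "'o set"
  Hom :: "'o \<Rightarrow> 'o \<Rightarrow> 'm set"
  Ide :: "'o \<Rightarrow> 'm"
  Cmp :: "'o \<Rightarrow> 'o \<Rightarrow> 'o \<Rightarrow> 'm \<Rightarrow> 'm \<Rightarrow> 'm"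

locale category =
  fixes A :: "('o, 'm) cat"
  assumes Ide_in: "x \<in> Ob A \<Longrightarrow> Ide A x \<in> Hom A x x"
    and Cmp_in: "\<lbrakk>x \<in> Ob A; y \<in> Ob A; z \<in> Ob A; f \<in> Hom A x y; g \<in> Hom A y z\<rbrakk>
                 \<Longrightarrow> Cmp A x y z g f \<in> Hom A x z"
    and Cmp_Ide: "\<lbrakk>x \<in> Ob A; y \<in> Ob A; f \<in> Hom A x y\<rbrakk> \<Longrightarrow> Cmp A x x y f (Ide A x) = f"
    and Ide_Cmp: "\<lbrakk>x \<in> Ob A; y \<in> Ob A; f \<in> Hom A x y\<rbrakk> \<Longrightarrow> Cmp A x y y (Ide A y) f = f"
    and Cmp_assoc: "\<lbrakk>w \<in> Ob A; x \<in> Ob A; y \<in> Ob A; z \<in> Ob A;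
                     f \<in> Hom A w x; g \<in> Hom A x y; h \<in> Hom A y z\<rbrakk>
                 \<Longrightarrow> Cmp A w y z h (Cmp A w x y g f) = Cmp A w x z (Cmp A x y z h g) f"

definition opp :: "('o, 'm) cat \<Rightarrow> ('o, 'm) cat" where
  "opp A = \<lparr>Ob = Ob A, Hom = (\<lambda>x y. Hom A y x), Ide = Ide A,
            Cmp = (\<lambda>x y z g f. Cmp A z y x f g)\<rparr>"

definition full_subcategory :: "('o, 'm) cat \<Rightarrow> ('o, 'm) cat \<Rightarrow> bool" where
  "full_subcategory A B \<longleftrightarrow> category A \<and> category B \<and> Ob A \<subseteq> Ob B \<and>
     (\<forall>x\<in>Ob A. Ide A x = Ide B x) \<and>
     (\<forall>x\<in>Ob A. \<forall>y\<in>Ob A. Hom A x y = Hom B x y) \<and>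
     (\<forall>x\<in>Ob A. \<forall>y\<in>Ob A. \<forall>z\<in>Ob A. \<forall>f\<in>Hom A x y. \<forall>g\<in>Hom A y z. Cmp A x y z g f = Cmp B x y z g f)"

text \<open>
  Functors and natural transformations take the value \<open>undefined\<close> off their domain, so that HOL
  equality is equality of functors and of natural transformations.
\<close>

record ('o, 'm, 'p, 'n) ftor =
  fob  :: "'o \<Rightarrow> 'p"
  farr :: "'o \<Rightarrow> 'o \<Rightarrow> 'm \<Rightarrow> 'n"

definition restrict_arr ::
  "('o, 'm) cat \<Rightarrow> ('o \<Rightarrow> 'o \<Rightarrow> 'm \<Rightarrow> 'n) \<Rightarrow> 'o \<Rightarrow> 'o \<Rightarrow> 'm \<Rightarrow> 'n" where
  "restrict_arr A t = (\<lambda>x y h. if x \<in> Ob A \<and> y \<in> Ob A \<and> h \<in> Hom A x y then t x y h else undefined)"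

locale cfunctor = A: category A + B: category B
  for A :: "('o, 'm) cat" and B :: "('p, 'n) cat" +
  fixes F :: "('o, 'm, 'p, 'n) ftor"
  assumes fob_in: "x \<in> Ob A \<Longrightarrow> fob F x \<in> Ob B"
    and farr_in: "\<lbrakk>x \<in> Ob A; y \<in> Ob A; h \<in> Hom A x y\<rbrakk>
                  \<Longrightarrow> farr F x y h \<in> Hom B (fob F x) (fob F y)"
    and farr_Ide: "x \<in> Ob A \<Longrightarrow> farr F x x (Ide A x) = Ide B (fob F x)"
    and farr_Cmp: "\<lbrakk>x \<in> Ob A; y \<in> Ob A; z \<in> Ob A; h \<in> Hom A x y; k \<in> Hom A y z\<rbrakk>
                  \<Longrightarrow> farr F x z (Cmp A x y z k h)
                      = Cmp B (fob F x) (fob F y) (fob F z) (farr F y z k) (farr F x y h)"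
    and fob_extensional: "fob F \<in> extensional (Ob A)"
    and farr_extensional: "farr F = restrict_arr A (farr F)"

definition id_functor :: "('o, 'm) cat \<Rightarrow> ('o, 'm, 'o, 'm) ftor" where
  "id_functor A = \<lparr>fob = (\<lambda>x\<in>Ob A. x), farr = restrict_arr A (\<lambda>x y h. h)\<rparr>"

text \<open>\<open>comp_functor A G F\<close> is \<open>G \<circ> F\<close>, where \<open>A\<close> is the domain of \<open>F\<close>.\<close>

definition comp_functor ::
  "('o, 'm) cat \<Rightarrow> ('p, 'n, 'q, 'k) ftor \<Rightarrow> ('o, 'm, 'p, 'n) ftor \<Rightarrow> ('o, 'm, 'q, 'k) ftor" where
  "comp_functor A G F =
     \<lparr>fob = (\<lambda>x\<in>Ob A. fob G (fob F x)),
      farr = restrict_arr A (\<lambda>x y h. farr G (fob F x) (fob F y) (farr F x y h))\<rparr>"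

definition opp_functor :: "('o, 'm, 'p, 'n) ftor \<Rightarrow> ('o, 'm, 'p, 'n) ftor" where
  "opp_functor F = \<lparr>fob = fob F, farr = (\<lambda>x y. farr F y x)\<rparr>"

locale nat_trans = F: cfunctor A B F + G: cfunctor A B G
  for A :: "('o, 'm) cat" and B :: "('p, 'n) cat" and F G +
  fixes \<alpha> :: "'o \<Rightarrow> 'n"
  assumes component_in: "x \<in> Ob A \<Longrightarrow> \<alpha> x \<in> Hom B (fob F x) (fob G x)"
    and naturality: "\<lbrakk>x \<in> Ob A; y \<in> Ob A; h \<in> Hom A x y\<rbrakk>
        \<Longrightarrow> Cmp B (fob F x) (fob F y) (fob G y) (\<alpha> y) (farr F x y h)
            = Cmp B (fob F x) (fob G x) (fob G y) (farr G x y h) (\<alpha> x)"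
    and extensional: "\<alpha> \<in> extensional (Ob A)"

definition is_iso :: "('o, 'm) cat \<Rightarrow> 'o \<Rightarrow> 'o \<Rightarrow> 'm \<Rightarrow> bool" where
  "is_iso A x y h \<longleftrightarrow> h \<in> Hom A x y \<and>
     (\<exists>k\<in>Hom A y x. Cmp A x y x k h = Ide A x \<and> Cmp A y x y h k = Ide A y)"

definition nat_iso ::
  "('o, 'm) cat \<Rightarrow> ('p, 'n) cat \<Rightarrow> ('o, 'm, 'p, 'n) ftor \<Rightarrow> ('o, 'm, 'p, 'n) ftor
   \<Rightarrow> ('o \<Rightarrow> 'n) \<Rightarrow> bool" where
  "nat_iso A B F G \<alpha> \<longleftrightarrow> nat_trans A B F G \<alpha> \<and>
     (\<forall>x\<in>Ob A. is_iso B (fob F x) (fob G x) (\<alpha> x))"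

definition equivalent :: "('o, 'm) cat \<Rightarrow> ('p, 'n) cat \<Rightarrow> bool" where
  "equivalent A B \<longleftrightarrow> (\<exists>F G \<alpha> \<beta>. cfunctor A B F \<and> cfunctor B A G \<and>
     nat_iso A A (id_functor A) (comp_functor A G F) \<alpha> \<and>
     nat_iso B B (comp_functor B F G) (id_functor B) \<beta>)"

text \<open>\<open>F\<close> is left adjoint to \<open>G\<close>, with the given unit and counit.\<close>

locale adjunction =
  F: cfunctor A B F + G: cfunctor B A G +
  unit: nat_trans A A "id_functor A" "comp_functor A G F" unit +
  counit: nat_trans B B "comp_functor B F G" "id_functor B" counit
  for A :: "('o, 'm) cat" and B :: "('p, 'n) cat" and F G unit counit +
  assumes triangle_left: "a \<in> Ob A \<Longrightarrow>
      Cmp B (fob F a) (fob F (fob G (fob F a))) (fob F a)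
        (counit (fob F a)) (farr F a (fob G (fob F a)) (unit a)) = Ide B (fob F a)"
    and triangle_right: "b \<in> Ob B \<Longrightarrow>
      Cmp A (fob G b) (fob G (fob F (fob G b))) (fob G b)
        (farr G (fob F (fob G b)) b (counit b)) (unit (fob G b)) = Ide A (fob G b)"


section \<open>Smallness of categories\<close>

definition small_category :: "'s::zf_sets \<Rightarrow> ('o, 'm) cat \<Rightarrow> bool" where
  "small_category U A \<longleftrightarrow> category A \<and>
     small U {(x, y, h). x \<in> Ob A \<and> y \<in> Ob A \<and> h \<in> Hom A x y}"

definition essentially_small :: "'s::zf_sets \<Rightarrow> ('o, 'm) cat \<Rightarrow> bool" where
  "essentially_small U A \<longleftrightarrow> (\<exists>E :: ('s, 's) cat. small_category U E \<and> equivalent A E)"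


section \<open>Presheaves\<close>

definition functor_cat ::
  "('o, 'm) cat \<Rightarrow> ('p, 'n) cat \<Rightarrow> (('o, 'm, 'p, 'n) ftor, 'o \<Rightarrow> 'n) cat" where
  "functor_cat A B =
     \<lparr>Ob = {F. cfunctor A B F},
      Hom = (\<lambda>F G. {\<alpha>. nat_trans A B F G \<alpha>}),
      Ide = (\<lambda>F. \<lambda>x\<in>Ob A. Ide B (fob F x)),
      Cmp = (\<lambda>F G H \<beta> \<alpha>. \<lambda>x\<in>Ob A. Cmp B (fob F x) (fob G x) (fob H x) (\<beta> x) (\<alpha> x))\<rparr>"

definition set_cat :: "'s::zf_sets \<Rightarrow> ('s set, 's \<Rightarrow> 's) cat" where
  "set_cat U =
     \<lparr>Ob = {X. small U X},
      Hom = (\<lambda>X Y. X \<rightarrow>\<^sub>E Y),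
      Ide = (\<lambda>X. \<lambda>x\<in>X. x),
      Cmp = (\<lambda>X Y Z g f. compose X g f)\<rparr>"

type_synonym ('o, 'm, 's) presheaf = "('o, 'm, 's set, 's \<Rightarrow> 's) ftor"

definition psh ::
  "'s::zf_sets \<Rightarrow> ('o, 'm) cat \<Rightarrow> (('o, 'm, 's) presheaf, 'o \<Rightarrow> 's \<Rightarrow> 's) cat" where
  "psh U A = functor_cat (opp A) (set_cat U)"

text \<open>\<open>precomp U A B g\<close> is \<open>g\<^sup>\<and> : B\<^sup>\<and> \<rightarrow> A\<^sup>\<and>\<close> for \<open>g : A \<rightarrow> B\<close>, with values in \<open>U\<close>-small sets.\<close>

definition precomp ::
  "'s::zf_sets \<Rightarrow> ('o, 'm) cat \<Rightarrow> ('p, 'n) cat \<Rightarrow> ('o, 'm, 'p, 'n) ftor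
   \<Rightarrow> (('p, 'n, 's) presheaf, 'p \<Rightarrow> 's \<Rightarrow> 's, ('o, 'm, 's) presheaf, 'o \<Rightarrow> 's \<Rightarrow> 's) ftor" where
  "precomp U A B g =
     \<lparr>fob = (\<lambda>u\<in>Ob (psh U B). comp_functor (opp A) u (opp_functor g)),
      farr = restrict_arr (psh U B) (\<lambda>u w \<beta>. \<lambda>x\<in>Ob A. \<beta> (fob g x))\<rparr>"

text \<open>
  A representable presheaf takes values in sets of the ambient set theory.  If the morphisms of \<open>A\<close>
  are not themselves elements of the type of sets, an encoding \<open>\<iota> x y\<close> of the morphisms \<open>x \<rightarrow> y\<close> as
  sets, injective on each hom-set, is needed: \<open>hom_set \<iota> A x y\<close> is then \<open>Hom A x y\<close> as a set of sets.
\<close>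

definition hom_set :: "('o \<Rightarrow> 'o \<Rightarrow> 'm \<Rightarrow> 's) \<Rightarrow> ('o, 'm) cat \<Rightarrow> 'o \<Rightarrow> 'o \<Rightarrow> 's::zf_sets set" where
  "hom_set \<iota> A x y = \<iota> x y ` Hom A x y"

definition decode :: "('o \<Rightarrow> 'o \<Rightarrow> 'm \<Rightarrow> 's) \<Rightarrow> ('o, 'm) cat \<Rightarrow> 'o \<Rightarrow> 'o \<Rightarrow> 's::zf_sets \<Rightarrow> 'm" where
  "decode \<iota> A x y = the_inv_into (Hom A x y) (\<iota> x y)"

definition yoneda_coded ::
  "('o \<Rightarrow> 'o \<Rightarrow> 'm \<Rightarrow> 's::zf_sets) \<Rightarrow> ('o, 'm) cat
   \<Rightarrow> ('o, 'm, ('o, 'm, 's) presheaf, 'o \<Rightarrow> 's \<Rightarrow> 's) ftor" where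
  "yoneda_coded \<iota> A =
     \<lparr>fob = (\<lambda>x\<in>Ob A.
        \<lparr>fob = (\<lambda>c\<in>Ob A. hom_set \<iota> A c x),
         farr = restrict_arr (opp A) (\<lambda>c c' h. \<lambda>s\<in>hom_set \<iota> A c x.
                  \<iota> c' x (Cmp A c' c x (decode \<iota> A c x s) h))\<rparr>),
      farr = restrict_arr A (\<lambda>x y g. \<lambda>c\<in>Ob A. \<lambda>s\<in>hom_set \<iota> A c x.
                  \<iota> c y (Cmp A c x y g (decode \<iota> A c x s)))\<rparr>"

abbreviation yoneda ::
  "('o, 's::zf_sets) cat \<Rightarrow> ('o, 's, ('o, 's, 's) presheaf, 'o \<Rightarrow> 's \<Rightarrow> 's) ftor" where
  "yoneda A \<equiv> yoneda_coded (\<lambda>x y h. h) A"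

text \<open>
  A natural transformation \<open>u \<rightarrow> v\<close> of presheaves on a category whose objects form a set is, as a
  set, the function \<open>c \<mapsto> \<alpha>\<^sub>c\<close> on \<open>Ob C\<close>, each \<open>\<alpha>\<^sub>c\<close> being a function on \<open>u(c)\<close>.
\<close>

definition nat_code ::
  "('s, 's) cat \<Rightarrow> ('s, 's, 's) presheaf \<Rightarrow> ('s, 's, 's) presheaf \<Rightarrow> ('s \<Rightarrow> 's \<Rightarrow> 's)
   \<Rightarrow> 's::zf_sets" where
  "nat_code C u v \<alpha> = vfun (Ob C) (\<lambda>c. vfun (fob u c) (\<alpha> c))"

abbreviation yoneda_psh ::
  "'s::zf_sets \<Rightarrow> ('s, 's) cat
   \<Rightarrow> (('s, 's, 's) presheaf, 's \<Rightarrow> 's \<Rightarrow> 's,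
       (('s, 's, 's) presheaf, 's \<Rightarrow> 's \<Rightarrow> 's, 's) presheaf, ('s, 's, 's) presheaf \<Rightarrow> 's \<Rightarrow> 's) ftor" where
  "yoneda_psh U C \<equiv> yoneda_coded (nat_code C) (psh U C)"


section \<open>The composite, the unit and the counit\<close>

definition composite ::
  "'s::zf_sets \<Rightarrow> 's \<Rightarrow> ('s, 's) cat \<Rightarrow> ('s, 's) cat \<Rightarrow> ('s, 's, 's, 's) ftor
   \<Rightarrow> (('s, 's, 's) presheaf, 's \<Rightarrow> 's \<Rightarrow> 's, ('s, 's, 's) presheaf, 's \<Rightarrow> 's \<Rightarrow> 's) ftor" where
  "composite U V C D f =
     comp_functor (psh U C) (precomp V D (psh U D) (yoneda D))
       (comp_functor (psh U C) (precomp V (psh U D) (psh U C) (precomp U C D f)) (yoneda_psh U C))"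

text \<open>The presheaf \<open>Hom\<^sub>D(f(-), d)\<close> on \<open>C\<close>.\<close>

definition hom_along ::
  "('s, 's) cat \<Rightarrow> ('s, 's) cat \<Rightarrow> ('s, 's, 's, 's) ftor \<Rightarrow> 's::zf_sets \<Rightarrow> ('s, 's, 's) presheaf" where
  "hom_along C D f d =
     \<lparr>fob = (\<lambda>c\<in>Ob C. Hom D (fob f c) d),
      farr = restrict_arr (opp C) (\<lambda>c c' h. \<lambda>a\<in>Hom D (fob f c) d.
               Cmp D (fob f c') (fob f c) d a (farr f c' c h))\<rparr>"

text \<open>In \<open>farr u d (fob f c) a\<close> the morphism \<open>a : f(c) \<rightarrow> d\<close> is read as \<open>d \<rightarrow> f(c)\<close> in the opposite of \<open>D\<close>.\<close>

definition unit_map ::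
  "'s::zf_sets \<Rightarrow> ('s, 's) cat \<Rightarrow> ('s, 's) cat \<Rightarrow> ('s, 's, 's, 's) ftor
   \<Rightarrow> ('s, 's, 's) presheaf \<Rightarrow> 's \<Rightarrow> 's \<Rightarrow> 's" where
  "unit_map U C D f =
     (\<lambda>u\<in>Ob (psh U D). \<lambda>d\<in>Ob D. \<lambda>x\<in>fob u d.
        nat_code C (hom_along C D f d) (comp_functor (opp C) u (opp_functor f))
          (\<lambda>c\<in>Ob C. \<lambda>a\<in>Hom D (fob f c) d. farr u d (fob f c) a x))"

definition counit_map ::
  "'s::zf_sets \<Rightarrow> ('s, 's) cat \<Rightarrow> ('s, 's) cat \<Rightarrow> ('s, 's, 's, 's) ftor
   \<Rightarrow> ('s, 's, 's) presheaf \<Rightarrow> 's \<Rightarrow> 's \<Rightarrow> 's" where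
  "counit_map U C D f =
     (\<lambda>v\<in>Ob (psh U C). \<lambda>c\<in>Ob C. \<lambda>\<xi>\<in>hom_set (nat_code C) (psh U C) (hom_along C D f (fob f c)) v.
        vapp (vapp \<xi> c) (Ide D (fob f c)))"

end

theory Submission
  imports Defs
begin

text \<open>
  By the Yoneda lemma a right adjoint of \<open>f\<^sup>\<and>\<close> must send \<open>v\<close> to \<open>d \<mapsto> Hom (f\<^sup>\<and> (y d), v)\<close>, which is
  the given composite.  Its values are \<open>U\<close>-small because a natural transformation of presheaves on
  an essentially \<open>U\<close>-small category is determined by a \<open>U\<close>-small family of components.  The unit
  and counit formulas are the Yoneda correspondence and its inverse, so naturality and the triangle
  identities reduce to evaluations at elements.
\<close>

section \<open>Sets and universes\<close>

text \<open>Presheaves take values in sets of the model, whereas a natural transformation is an HOL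
  function. The elements of \<open>fob (fob \<phi> v) d\<close> are therefore codes, and each
  formula for the unit or the counit must be decoded before it can be computed; injectivity of
  \<open>nat_code\<close> is what permits this. The second obstacle is size: \<open>Ob C\<close> may
  be far larger than every element of \<open>U\<close>, so Hom(u, v) cannot be bounded by a product
  over \<open>Ob C\<close>. The product runs over the objects of an equivalent small category, and
  the isomorphisms of the equivalence carry equality of components from there to all of
  \<open>Ob C\<close>. The functor \<phi> is the composite itself, read with the smaller codomain
  \<open>psh U D\<close>.\<close>

lemma elts_vset [simp]: "is_set A \<Longrightarrow> elts (vset A) = A"
  unfolding is_set_def vset_def by (rule theI') (metis extensionality)

lemma is_set_elts [simp]: "is_set (elts x)"
  by (auto simp: is_set_def)

lemma is_set_pair [simp]: "is_set {x, y}"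
  using pairing by (auto simp: is_set_def)

lemma is_set_singleton [simp]: "is_set {x}"
  using is_set_pair[of x x] by simp

lemma is_set_image: "is_set A \<Longrightarrow> is_set (h ` A)" for h :: "'s::zf_sets \<Rightarrow> 's"
  using replacement[where h = h] by (auto simp: is_set_def)

lemma is_set_UN:
  fixes X :: "'s::zf_sets \<Rightarrow> 's"
  assumes "is_set I" shows "is_set (\<Union>i\<in>I. elts (X i))"
proof -
  obtain z where z: "elts z = X ` I" using is_set_image[OF assms] unfolding is_set_def by metis
  obtain y where "elts y = (\<Union>x\<in>elts z. elts x)" using union by blast
  then show ?thesis unfolding is_set_def z by auto
qed

text \<open>Separation comes from replacement: points outside \<open>B\<close> are sent to a fixed
  point of \<open>B\<close>. The empty class has no such point; that it is a set is read off from
  the axiom of infinity.\<close>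

lemma is_set_subset:
  assumes "is_set A" "B \<subseteq> A" shows "is_set B"
proof (cases "B = {}")
  case True
  then show ?thesis using infinity unfolding is_set_def by metis
next
  case False
  then obtain b where "b \<in> B" by blast
  then have "(\<lambda>x. if x \<in> B then x else b) ` A = B" using assms(2) by auto
  then show ?thesis using is_set_image[OF assms(1)] by metis
qed

lemma is_set_powerset [simp]: "is_set {y. elts y \<subseteq> elts x}"
  using powerset by (auto simp: is_set_def)

lemma vset_inject: "is_set A \<Longrightarrow> is_set B \<Longrightarrow> vset A = vset B \<longleftrightarrow> A = B"
  by (metis elts_vset)

lemma vpair_inject [simp]: "vpair x y = vpair x' y' \<longleftrightarrow> x = x' \<and> y = y'"
  by (simp add: vpair_def vset_inject doubleton_eq_iff) auto

lemma vapp_vfun [simp]: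
  assumes "is_set A" "x \<in> A" shows "vapp (vfun A h) x = h x"
  using assms by (auto simp: vapp_def vfun_def is_set_image)

section \<open>Closure properties of a universe and of its small sets\<close>

lemma universe_trans: "universe U \<Longrightarrow> x \<in> elts y \<Longrightarrow> y \<in> elts U \<Longrightarrow> x \<in> elts U"
  unfolding universe_def by blast

lemma universe_pair: "universe U \<Longrightarrow> x \<in> elts U \<Longrightarrow> y \<in> elts U \<Longrightarrow> vset {x, y} \<in> elts U"
  unfolding universe_def by blast

lemma universe_powerset: "universe U \<Longrightarrow> x \<in> elts U \<Longrightarrow> vset {y. elts y \<subseteq> elts x} \<in> elts U"
  unfolding universe_def by blast

lemma universe_UN:
  "universe U \<Longrightarrow> I \<in> elts U \<Longrightarrow> (\<And>i. i \<in> elts I \<Longrightarrow> X i \<in> elts U)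
    \<Longrightarrow> vset (\<Union>i\<in>elts I. elts (X i)) \<in> elts U"
  unfolding universe_def by blast

lemma universe_subset:
  assumes "universe U" "x \<in> elts U" "elts y \<subseteq> elts x" shows "y \<in> elts U"
  using universe_trans[OF assms(1) _ universe_powerset[OF assms(1,2)], of y] assms(3) by simp

lemma universe_vpair:
  assumes "universe U" "x \<in> elts U" "y \<in> elts U" shows "vpair x y \<in> elts U"
  using universe_pair[OF assms(1)] assms(2,3) unfolding vpair_def by (metis insert_absorb2)

lemma universe_product:
  assumes U: "universe U" and "x \<in> elts U" "y \<in> elts U"
  obtains p where "p \<in> elts U" "\<And>a b. a \<in> elts x \<Longrightarrow> b \<in> elts y \<Longrightarrow> vpair a b \<in> elts p"
proof -
  \<comment> \<open>Singletons are written \<open>vset {z, z}\<close> so that closure under pairs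
    yields them; closure under unions, over \<open>y\<close> and then over \<open>x\<close>,
    collects all pairs.\<close>
  define row where "row a = vset (\<Union>b\<in>elts y. elts (vset {vpair a b, vpair a b}))" for a
  define p where "p = vset (\<Union>a\<in>elts x. elts (row a))"
  have "a \<in> elts x \<Longrightarrow> row a \<in> elts U" for a
    unfolding row_def using assms
    by (intro universe_UN universe_pair universe_vpair) (blast intro: universe_trans)+
  then have "p \<in> elts U" unfolding p_def using assms by (intro universe_UN)
  moreover have "vpair a b \<in> elts p" if "a \<in> elts x" "b \<in> elts y" for a b
  proof -
    have "elts (row a) = (\<Union>b\<in>elts y. {vpair a b})" for a
      unfolding row_def by (subst elts_vset[OF is_set_UN]) simp_all
    then show ?thesis using that unfolding p_def by (subst elts_vset[OF is_set_UN]) auto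
  qed
  ultimately show thesis using that by blast
qed

text \<open>Transporting \<open>A\<close> into an element of \<open>U\<close> that represents
  \<open>B\<close> gives a subclass of it, hence a set by separation, and \<open>U\<close> contains
  the subsets of its elements.\<close>

lemma small_inj:
  assumes U: "universe U" and "small U B" and g: "inj_on g A" "g ` A \<subseteq> B"
  shows "small U A"
proof -
  obtain x b where x: "x \<in> elts U" and b: "bij_betw b B (elts x)"
    using assms(2) unfolding small_def by blast
  have sub: "(b \<circ> g) ` A \<subseteq> elts x" using b g(2) by (auto simp: bij_betw_def)
  then have s: "is_set ((b \<circ> g) ` A)" using is_set_subset[OF is_set_elts] by blast
  have "inj_on (b \<circ> g) A"
    using b g by (meson bij_betw_def comp_inj_on inj_on_subset)
  then have "bij_betw (b \<circ> g) A (elts (vset ((b \<circ> g) ` A)))"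
    unfolding bij_betw_def elts_vset[OF s] by blast
  moreover have "vset ((b \<circ> g) ` A) \<in> elts U"
    using universe_subset[OF U x] sub s by simp
  ultimately show ?thesis unfolding small_def by blast
qed

text \<open>The bijection is an arbitrary HOL function, so replacement applies to its
  inverse.\<close>

lemma small_is_set:
  fixes U :: "'s::zf_sets" and A :: "'s set"
  assumes "small U A" shows "is_set A"
proof -
  obtain x :: 's and b where "bij_betw b A (elts x)"
    using assms unfolding small_def by blast
  then have "A = the_inv_into A b ` elts x"
    using bij_betw_the_inv_into[of b A] by (simp add: bij_betw_def)
  then show ?thesis using is_set_image[OF is_set_elts] by metis
qed

lemma small_in_larger_universe:
  "universe V \<Longrightarrow> U \<in> elts V \<Longrightarrow> small U A \<Longrightarrow> small V A"
  unfolding small_def by (meson universe_trans)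

text \<open>Families are encoded by their graphs, inside the product of the index set and the union.\<close>

lemma small_PiE:
  assumes U: "universe U" and I: "small U I" and X: "\<And>i. i \<in> I \<Longrightarrow> small U (X i)"
  shows "small U (PiE I X)"
proof -
  obtain j b where j: "j \<in> elts U" and b: "bij_betw b I (elts j)"
    using I unfolding small_def by blast
  have "\<forall>i\<in>I. \<exists>x c. x \<in> elts U \<and> bij_betw c (X i) (elts x)"
    using X unfolding small_def by blast
  then obtain x c where x: "\<And>i. i \<in> I \<Longrightarrow> x i \<in> elts U"
    and c: "\<And>i. i \<in> I \<Longrightarrow> bij_betw (c i) (X i) (elts (x i))" by metis
  \<comment> \<open>Closure under unions asks for an index set in \<open>U\<close>, so the index is
    moved from \<open>I\<close> to \<open>j\<close>; \<open>y\<close> then holds the transported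
    values of all families at once.\<close>
  define y where "y = vset (\<Union>k\<in>elts j. elts (x (the_inv_into I b k)))"
  have inv: "the_inv_into I b k \<in> I" if "k \<in> elts j" for k
    using b that by (metis bij_betw_apply bij_betw_the_inv_into)
  have y: "y \<in> elts U" unfolding y_def using U j inv x by (intro universe_UN) auto
  have cy: "c i s \<in> elts y" if "i \<in> I" "s \<in> X i" for i s
  proof -
    have "b i \<in> elts j" "the_inv_into I b (b i) = i" "c i s \<in> elts (x i)"
      using b c that by (auto simp: bij_betw_def the_inv_into_f_f)
    then show ?thesis unfolding y_def
      by (subst elts_vset[OF is_set_UN]) (auto intro!: bexI[of _ "b i"])
  qed
  obtain p where p: "p \<in> elts U" "\<And>s t. s \<in> elts j \<Longrightarrow> t \<in> elts y \<Longrightarrow> vpair s t \<in> elts p"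
    using universe_product[OF U j y] by blast
  define G where "G g = (\<lambda>i. vpair (b i) (c i (g i))) ` I" for g
  have Gp: "G g \<subseteq> elts p" if "g \<in> PiE I X" for g
    unfolding G_def using that b by (auto intro!: p(2) cy simp: bij_betw_def)
  have sG: "is_set (G g)" if "g \<in> PiE I X" for g
    using is_set_subset[OF is_set_elts Gp[OF that]] .
  have "inj_on (vset \<circ> G) (PiE I X)"
  proof (rule inj_onI)
    fix g h assume g: "g \<in> PiE I X" and h: "h \<in> PiE I X" and "(vset \<circ> G) g = (vset \<circ> G) h"
    then have GG: "G g = G h" using sG by (simp add: vset_inject)
    show "g = h"
    proof (rule PiE_ext[OF g h])
      fix i assume i: "i \<in> I"
      then have "vpair (b i) (c i (g i)) \<in> G h" using GG unfolding G_def by blast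
      then obtain i' where i': "i' \<in> I" "b i = b i'" "c i (g i) = c i' (h i')"
        unfolding G_def by auto
      then have "i' = i" using b i by (auto simp: bij_betw_def inj_on_def)
      moreover have "g i \<in> X i" "h i \<in> X i" using g h i by auto
      ultimately show "g i = h i" using i' c[OF i] by (auto simp: bij_betw_def inj_on_def)
    qed
  qed
  \<comment> \<open>As subsets of \<open>p\<close>, all the graphs lie in the power set of
    \<open>p\<close>, which is again in \<open>U\<close>.\<close>
  moreover have "(vset \<circ> G) ` PiE I X \<subseteq> elts (vset {z. elts z \<subseteq> elts p})"
    using Gp sG by (simp add: image_subset_iff)
  moreover have "small U (elts (vset {z. elts z \<subseteq> elts p}))"
    unfolding small_def using universe_powerset[OF U p(1)] by (meson bij_betw_id)
  ultimately show ?thesis using small_inj[OF U] by blast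
qed

section \<open>Categories and functors\<close>

lemma opp_simps [simp]:
  "Ob (opp A) = Ob A" "Hom (opp A) x y = Hom A y x" "Ide (opp A) = Ide A"
  "Cmp (opp A) x y z g h = Cmp A z y x h g"
  by (simp_all add: opp_def)

lemma set_cat_simps [simp]:
  "Ob (set_cat U) = {X. small U X}" "Hom (set_cat U) X Y = X \<rightarrow>\<^sub>E Y"
  "Ide (set_cat U) X = (\<lambda>x\<in>X. x)" "Cmp (set_cat U) X Y Z g h = compose X g h"
  by (simp_all add: set_cat_def)

lemma functor_cat_simps [simp]:
  "Ob (functor_cat A B) = {F. cfunctor A B F}"
  "Hom (functor_cat A B) F G = {\<alpha>. nat_trans A B F G \<alpha>}"
  "Ide (functor_cat A B) F = (\<lambda>x\<in>Ob A. Ide B (fob F x))"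
  "Cmp (functor_cat A B) F G H \<beta> \<alpha>
     = (\<lambda>x\<in>Ob A. Cmp B (fob F x) (fob G x) (fob H x) (\<beta> x) (\<alpha> x))"
  by (simp_all add: functor_cat_def)

lemma restrict_arr_apply [simp]:
  "x \<in> Ob A \<Longrightarrow> y \<in> Ob A \<Longrightarrow> h \<in> Hom A x y \<Longrightarrow> restrict_arr A t x y h = t x y h"
  by (simp add: restrict_arr_def)

lemma restrict_arr_idem [simp]: "restrict_arr A (restrict_arr A t) = restrict_arr A t"
  by (auto simp: restrict_arr_def fun_eq_iff)

lemma restrict_arr_cong:
  "(\<And>x y h. x \<in> Ob A \<Longrightarrow> y \<in> Ob A \<Longrightarrow> h \<in> Hom A x y \<Longrightarrow> s x y h = t x y h)
    \<Longrightarrow> restrict_arr A s = restrict_arr A t"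
  by (auto simp: restrict_arr_def fun_eq_iff)

lemma comp_functor_simps [simp]:
  "x \<in> Ob A \<Longrightarrow> fob (comp_functor A G F) x = fob G (fob F x)"
  "x \<in> Ob A \<Longrightarrow> y \<in> Ob A \<Longrightarrow> h \<in> Hom A x y \<Longrightarrow>
    farr (comp_functor A G F) x y h = farr G (fob F x) (fob F y) (farr F x y h)"
  by (simp_all add: comp_functor_def)

lemma opp_functor_simps [simp]:
  "fob (opp_functor F) = fob F" "farr (opp_functor F) x y = farr F y x"
  by (simp_all add: opp_functor_def)

lemma id_functor_simps [simp]:
  "x \<in> Ob A \<Longrightarrow> fob (id_functor A) x = x"
  "x \<in> Ob A \<Longrightarrow> y \<in> Ob A \<Longrightarrow> h \<in> Hom A x y \<Longrightarrow> farr (id_functor A) x y h = h"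
  by (simp_all add: id_functor_def)

lemma category_opp: "category A \<Longrightarrow> category (opp A)"
  by (intro category.intro)
     (simp_all add: category.Ide_in category.Cmp_in category.Cmp_Ide category.Ide_Cmp
       category.Cmp_assoc)

lemma category_set_cat: "category (set_cat U)"
  by (standard; (simp; fail)?)
     (auto simp: compose_def fun_eq_iff PiE_def Pi_def extensional_def)

lemma category_functor_cat:
  assumes A: "category A" and B: "category B" shows "category (functor_cat A B)"
proof -
  interpret A: category A by fact
  interpret B: category B by fact
  show ?thesis
  proof (standard, goal_cases)
    case (1 F)
    then interpret F: cfunctor A B F by simp
    show ?case
      by simp (standard; simp add: F.fob_in F.farr_in B.Ide_in B.Cmp_Ide B.Ide_Cmp)
  next
    case (2 F G H \<alpha> \<beta>)
    then interpret a: nat_trans A B F G \<alpha> by simp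
    interpret b: nat_trans A B G H \<beta> using 2 by simp
    show ?case
    proof (simp, standard, goal_cases)
      case (1 x)
      then show ?case
        by (auto intro!: B.Cmp_in a.F.fob_in a.G.fob_in b.G.fob_in a.component_in b.component_in)
    next
      case (2 x y h)
      note i = a.F.fob_in[OF 2(1)] a.F.fob_in[OF 2(2)] a.G.fob_in[OF 2(1)] a.G.fob_in[OF 2(2)]
        b.G.fob_in[OF 2(1)] b.G.fob_in[OF 2(2)] a.component_in[OF 2(1)] a.component_in[OF 2(2)]
        b.component_in[OF 2(1)] b.component_in[OF 2(2)]
        a.F.farr_in[OF 2] a.G.farr_in[OF 2] b.G.farr_in[OF 2]
      \<comment> \<open>Pasting of two naturality squares: the arrow is moved past
        \<open>\<alpha> y\<close>'s square and then past that of \<beta>, with reassociation in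
        between.\<close>
      have "Cmp B (fob F x) (fob F y) (fob H y)
              (Cmp B (fob F y) (fob G y) (fob H y) (\<beta> y) (\<alpha> y)) (farr F x y h)
          = Cmp B (fob F x) (fob G y) (fob H y) (\<beta> y)
              (Cmp B (fob F x) (fob F y) (fob G y) (\<alpha> y) (farr F x y h))"
        using i by (intro B.Cmp_assoc[symmetric])
      also have "\<dots> = Cmp B (fob F x) (fob G y) (fob H y) (\<beta> y)
              (Cmp B (fob F x) (fob G x) (fob G y) (farr G x y h) (\<alpha> x))"
        using a.naturality[OF 2] by simp
      also have "\<dots> = Cmp B (fob F x) (fob G x) (fob H y)
              (Cmp B (fob G x) (fob G y) (fob H y) (\<beta> y) (farr G x y h)) (\<alpha> x)"
        using i by (intro B.Cmp_assoc)
      also have "\<dots> = Cmp B (fob F x) (fob G x) (fob H y)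
              (Cmp B (fob G x) (fob H x) (fob H y) (farr H x y h) (\<beta> x)) (\<alpha> x)"
        using b.naturality[OF 2] by simp
      also have "\<dots> = Cmp B (fob F x) (fob H x) (fob H y) (farr H x y h)
              (Cmp B (fob F x) (fob G x) (fob H x) (\<beta> x) (\<alpha> x))"
        using i by (intro B.Cmp_assoc[symmetric])
      finally show ?case using 2 by simp
    qed simp
  next
    case (3 F G \<alpha>)
    then interpret a: nat_trans A B F G \<alpha> by simp
    show ?case
      by (rule extensionalityI[where A = "Ob A"])
         (simp_all add: a.extensional B.Cmp_Ide a.component_in a.F.fob_in a.G.fob_in)
  next
    case (4 F G \<alpha>)
    then interpret a: nat_trans A B F G \<alpha> by simp
    show ?case
      by (rule extensionalityI[where A = "Ob A"])
         (simp_all add: a.extensional B.Ide_Cmp a.component_in a.F.fob_in a.G.fob_in)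
  next
    case (5 F G H K \<alpha> \<beta> \<gamma>)
    then interpret a: nat_trans A B F G \<alpha> by simp
    interpret b: nat_trans A B G H \<beta> using 5 by simp
    interpret c: nat_trans A B H K \<gamma> using 5 by simp
    show ?case
      by (auto simp: fun_eq_iff restrict_def intro!: B.Cmp_assoc a.component_in b.component_in
          c.component_in a.F.fob_in a.G.fob_in b.G.fob_in c.G.fob_in)
  qed
qed

lemma category_psh: "category A \<Longrightarrow> category (psh U A)"
  unfolding psh_def by (intro category_functor_cat category_opp category_set_cat)

section \<open>Opposite, composite and identity functors\<close>

lemma cfunctor_opp:
  assumes "cfunctor A B F" shows "cfunctor (opp A) (opp B) (opp_functor F)"
proof -
  interpret F: cfunctor A B F by fact
  show ?thesis
  proof (intro cfunctor.intro cfunctor_axioms.intro category_opp F.A.category_axioms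
      F.B.category_axioms, goal_cases)
    case 6
    have "restrict_arr (opp A) (\<lambda>x y. farr F y x) = (\<lambda>x y. restrict_arr A (farr F) y x)"
      by (auto simp: restrict_arr_def fun_eq_iff)
    then show ?case using F.farr_extensional by (simp add: opp_functor_def)
  qed (simp_all add: F.fob_in F.farr_in F.farr_Ide F.farr_Cmp F.fob_extensional)
qed

lemma cfunctor_comp:
  assumes "cfunctor A B F" "cfunctor B C G" shows "cfunctor A C (comp_functor A G F)"
proof -
  interpret F: cfunctor A B F by fact
  interpret G: cfunctor B C G by fact
  show ?thesis
  proof (intro cfunctor.intro cfunctor_axioms.intro F.A.category_axioms
      G.B.category_axioms, goal_cases)
    case 4
    then show ?case by (simp add: F.A.Cmp_in F.farr_Cmp G.farr_Cmp F.fob_in F.farr_in)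
  qed (simp_all add: F.fob_in F.farr_in F.farr_Ide F.A.Ide_in G.farr_Ide G.fob_in G.farr_in,
      simp_all add: comp_functor_def)
qed

lemma cfunctor_id: "category A \<Longrightarrow> cfunctor A A (id_functor A)"
  by (intro cfunctor.intro cfunctor_axioms.intro)
     (simp_all add: category.Ide_in category.Cmp_in, simp_all add: id_functor_def)

lemma comp_id_functor:
  assumes "cfunctor A B F" shows "comp_functor A (id_functor B) F = F"
proof -
  interpret F: cfunctor A B F by fact
  have "restrict_arr A (\<lambda>x y h. farr (id_functor B) (fob F x) (fob F y) (farr F x y h))
      = restrict_arr A (farr F)"
    by (rule restrict_arr_cong) (simp add: F.fob_in F.farr_in)
  moreover have "(\<lambda>x\<in>Ob A. fob (id_functor B) (fob F x)) = fob F"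
    by (rule extensionalityI[where A = "Ob A"]) (simp_all add: F.fob_in F.fob_extensional)
  ultimately show ?thesis
    unfolding comp_functor_def using F.farr_extensional by simp
qed

text \<open>A functor record does not store its codomain, and a full subcategory has the same
  hom-sets, identities and composites; landing in \<open>Ob A\<close> on objects thus suffices, and
  the record is unchanged.\<close>

lemma cfunctor_into_full_subcategory:
  assumes "full_subcategory A B" "cfunctor X B F" "\<And>x. x \<in> Ob X \<Longrightarrow> fob F x \<in> Ob A"
  shows "cfunctor X A F"
proof -
  interpret F: cfunctor X B F by fact
  have f: "category A" "Ob A \<subseteq> Ob B" "\<And>x. x \<in> Ob A \<Longrightarrow> Ide A x = Ide B x"
    "\<And>x y. x \<in> Ob A \<Longrightarrow> y \<in> Ob A \<Longrightarrow> Hom A x y = Hom B x y"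
    "\<And>x y z g h. x \<in> Ob A \<Longrightarrow> y \<in> Ob A \<Longrightarrow> z \<in> Ob A \<Longrightarrow> h \<in> Hom A x y \<Longrightarrow> g \<in> Hom A y z
      \<Longrightarrow> Cmp A x y z g h = Cmp B x y z g h"
    using assms(1) unfolding full_subcategory_def by blast+
  show ?thesis
    by (intro cfunctor.intro cfunctor_axioms.intro F.A.category_axioms f(1) F.fob_extensional
        F.farr_extensional) (simp_all add: assms(3) f F.farr_in F.farr_Ide F.farr_Cmp)
qed

section \<open>Presheaves\<close>

text \<open>Reduces functoriality to equations at elements: both sides of an equation of maps are
  extensional on \<open>fob u x\<close>, so agreement there is equality.\<close>

lemma psh_ObI:
  assumes "category A" "fob u \<in> extensional (Ob A)" "farr u = restrict_arr (opp A) (farr u)"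
    and "\<And>x. x \<in> Ob A \<Longrightarrow> small U (fob u x)"
    and "\<And>x y h. x \<in> Ob A \<Longrightarrow> y \<in> Ob A \<Longrightarrow> h \<in> Hom A y x \<Longrightarrow> farr u x y h \<in> fob u x \<rightarrow>\<^sub>E fob u y"
    and "\<And>x s. x \<in> Ob A \<Longrightarrow> s \<in> fob u x \<Longrightarrow> farr u x x (Ide A x) s = s"
    and "\<And>x y z h k s. x \<in> Ob A \<Longrightarrow> y \<in> Ob A \<Longrightarrow> z \<in> Ob A \<Longrightarrow> h \<in> Hom A y x \<Longrightarrow> k \<in> Hom A z y
          \<Longrightarrow> s \<in> fob u x \<Longrightarrow> farr u x z (Cmp A z y x h k) s = farr u y z k (farr u x y h s)"
  shows "u \<in> Ob (psh U A)"
proof -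
  interpret A: category A by fact
  have "cfunctor (opp A) (set_cat U) u"
  proof (intro cfunctor.intro cfunctor_axioms.intro category_opp category_set_cat, goal_cases)
    case (4 x)
    then have "farr u x x (Ide A x) \<in> fob u x \<rightarrow>\<^sub>E fob u x"
      using assms(5) A.Ide_in by simp
    then show ?case using 4 assms(6)
      by (intro extensionalityI[where A = "fob u x"]) (auto simp: PiE_iff)
  next
    case (5 x y z h k)
    then have "farr u x z (Cmp A z y x h k) \<in> fob u x \<rightarrow>\<^sub>E fob u z"
      using assms(5) A.Cmp_in by simp
    then show ?case using 5 assms(7)
      by (intro extensionalityI[where A = "fob u x"]) (auto simp: PiE_iff compose_def)
  qed (use assms in simp_all)
  then show ?thesis by (simp add: psh_def)
qed

lemma psh_Ob_iff: "u \<in> Ob (psh U A) \<longleftrightarrow> cfunctor (opp A) (set_cat U) u"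
  by (simp add: psh_def)

context
  fixes U :: "'s::zf_sets" and A :: "('o, 'm) cat" and u :: "('o, 'm, 's) presheaf"
  assumes u: "u \<in> Ob (psh U A)"
begin

interpretation u: cfunctor "opp A" "set_cat U" u
  using u by (simp add: psh_Ob_iff)

lemma psh_extensional:
  "fob u \<in> extensional (Ob A)" "farr u = restrict_arr (opp A) (farr u)"
  using u.fob_extensional u.farr_extensional by simp_all

lemma psh_small: "x \<in> Ob A \<Longrightarrow> small U (fob u x)"
  using u.fob_in by simp

lemma psh_farr_in:
  "x \<in> Ob A \<Longrightarrow> y \<in> Ob A \<Longrightarrow> h \<in> Hom A y x \<Longrightarrow> farr u x y h \<in> fob u x \<rightarrow>\<^sub>E fob u y"
  using u.farr_in by simp

lemma psh_farr_app:
  "x \<in> Ob A \<Longrightarrow> y \<in> Ob A \<Longrightarrow> h \<in> Hom A y x \<Longrightarrow> s \<in> fob u x \<Longrightarrow> farr u x y h s \<in> fob u y"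
  using psh_farr_in by blast

lemma psh_farr_Ide: "x \<in> Ob A \<Longrightarrow> s \<in> fob u x \<Longrightarrow> farr u x x (Ide A x) s = s"
  using u.farr_Ide by simp

lemma psh_farr_Cmp:
  "\<lbrakk>x \<in> Ob A; y \<in> Ob A; z \<in> Ob A; h \<in> Hom A y x; k \<in> Hom A z y; s \<in> fob u x\<rbrakk>
    \<Longrightarrow> farr u x z (Cmp A z y x h k) s = farr u y z k (farr u x y h s)"
  using u.farr_Cmp[of x y z h k] by (simp add: compose_def)

end

lemma psh_HomI:
  assumes "u \<in> Ob (psh U A)" "v \<in> Ob (psh U A)"
    and "\<And>x. x \<in> Ob A \<Longrightarrow> \<alpha> x \<in> fob u x \<rightarrow>\<^sub>E fob v x"
    and "\<And>x y h s. x \<in> Ob A \<Longrightarrow> y \<in> Ob A \<Longrightarrow> h \<in> Hom A y x \<Longrightarrow> s \<in> fob u x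
          \<Longrightarrow> \<alpha> y (farr u x y h s) = farr v x y h (\<alpha> x s)"
    and "\<alpha> \<in> extensional (Ob A)"
  shows "\<alpha> \<in> Hom (psh U A) u v"
  unfolding psh_def functor_cat_simps mem_Collect_eq
  by (intro nat_trans.intro nat_trans_axioms.intro)
     (use assms in \<open>auto simp: psh_Ob_iff compose_def restrict_def fun_eq_iff\<close>)

context
  fixes U :: "'s::zf_sets" and A :: "('o, 'm) cat" and u v :: "('o, 'm, 's) presheaf" and \<alpha>
  assumes \<alpha>: "\<alpha> \<in> Hom (psh U A) u v"
begin

interpretation \<alpha>: nat_trans "opp A" "set_cat U" u v \<alpha>
  using \<alpha> by (simp add: psh_def)

lemma psh_Hom_dom: "u \<in> Ob (psh U A)" and psh_Hom_cod: "v \<in> Ob (psh U A)"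
  by (simp_all add: psh_Ob_iff \<alpha>.F.cfunctor_axioms \<alpha>.G.cfunctor_axioms)

lemma psh_Hom_component: "x \<in> Ob A \<Longrightarrow> \<alpha> x \<in> fob u x \<rightarrow>\<^sub>E fob v x"
  using \<alpha>.component_in by simp

lemma psh_Hom_app: "x \<in> Ob A \<Longrightarrow> s \<in> fob u x \<Longrightarrow> \<alpha> x s \<in> fob v x"
  using psh_Hom_component by blast

lemma psh_Hom_natural:
  "\<lbrakk>x \<in> Ob A; y \<in> Ob A; h \<in> Hom A y x; s \<in> fob u x\<rbrakk>
    \<Longrightarrow> \<alpha> y (farr u x y h s) = farr v x y h (\<alpha> x s)"
  using \<alpha>.naturality[of x y h] by (auto simp: compose_def fun_eq_iff) metis

lemma psh_Hom_extensional: "\<alpha> \<in> extensional (Ob A)"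
  using \<alpha>.extensional by simp

end

lemma psh_Hom_eqI:
  assumes "\<alpha> \<in> Hom (psh U A) u v" "\<beta> \<in> Hom (psh U' A) u v'"
    and "\<And>x s. x \<in> Ob A \<Longrightarrow> s \<in> fob u x \<Longrightarrow> \<alpha> x s = \<beta> x s"
  shows "\<alpha> = \<beta>"
proof (rule extensionalityI[where A = "Ob A"])
  fix x assume x: "x \<in> Ob A"
  show "\<alpha> x = \<beta> x"
    using psh_Hom_component[OF assms(1) x] psh_Hom_component[OF assms(2) x] assms(3)[OF x]
    by (intro extensionalityI[where A = "fob u x"]) (auto simp: PiE_iff)
qed (use assms psh_Hom_extensional in blast)+

lemma psh_Ide [simp]: "Ide (psh U A) u = (\<lambda>x\<in>Ob A. \<lambda>s\<in>fob u x. s)"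
  by (simp add: psh_def)

lemma psh_Cmp [simp]:
  "Cmp (psh U A) u v w \<beta> \<alpha> = (\<lambda>x\<in>Ob A. \<lambda>s\<in>fob u x. \<beta> x (\<alpha> x s))"
  by (simp add: psh_def compose_def)

text \<open>The universe enters a presheaf only through the smallness of its values, which passes
  from \<open>U\<close> to \<open>V\<close>; the conditions on a natural transformation between
  given presheaves speak of elements and arrows alone.\<close>

lemma psh_full_subcategory:
  assumes "universe V" "U \<in> elts V" "category A"
  shows "full_subcategory (psh U A) (psh V A)"
proof -
  have Ob: "u \<in> Ob (psh V A)" if u: "u \<in> Ob (psh U A)" for u
    using assms psh_extensional[OF u]
    by (intro psh_ObI psh_farr_in[OF u] psh_farr_Ide[OF u] psh_farr_Cmp[OF u]
        small_in_larger_universe[OF assms(1,2)] psh_small[OF u])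
  have Hom: "Hom (psh U A) u v = Hom (psh V A) u v"
    if u: "u \<in> Ob (psh U A)" and v: "v \<in> Ob (psh U A)" for u v
  proof (intro equalityI subsetI)
    fix \<alpha> assume a: "\<alpha> \<in> Hom (psh U A) u v"
    then show "\<alpha> \<in> Hom (psh V A) u v"
      by (intro psh_HomI Ob u v psh_Hom_component[OF a] psh_Hom_natural[OF a]
          psh_Hom_extensional[OF a])
  next
    fix \<alpha> assume a: "\<alpha> \<in> Hom (psh V A) u v"
    then show "\<alpha> \<in> Hom (psh U A) u v"
      by (intro psh_HomI u v psh_Hom_component[OF a] psh_Hom_natural[OF a]
          psh_Hom_extensional[OF a])
  qed
  show ?thesis
    unfolding full_subcategory_def using Ob Hom assms(3) by (auto simp: category_psh)
qed

section \<open>Precomposition functors\<close>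

lemma precomp_simps [simp]:
  "u \<in> Ob (psh U B) \<Longrightarrow> fob (precomp U A B g) u = comp_functor (opp A) u (opp_functor g)"
  "u \<in> Ob (psh U B) \<Longrightarrow> w \<in> Ob (psh U B) \<Longrightarrow> \<beta> \<in> Hom (psh U B) u w
    \<Longrightarrow> farr (precomp U A B g) u w \<beta> = (\<lambda>x\<in>Ob A. \<beta> (fob g x))"
  by (simp_all add: precomp_def)

lemma cfunctor_precomp:
  assumes g: "cfunctor A B g"
  shows "cfunctor (psh U B) (psh U A) (precomp U A B g)"
proof -
  interpret g: cfunctor A B g by fact
  have Ob: "comp_functor (opp A) u (opp_functor g) \<in> Ob (psh U A)" if "u \<in> Ob (psh U B)" for u
    using that cfunctor_comp[OF cfunctor_opp[OF g]] by (simp add: psh_Ob_iff)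
  interpret PB: category "psh U B" by (simp add: category_psh g.B.category_axioms)
  show ?thesis
  proof (intro cfunctor.intro cfunctor_axioms.intro category_psh g.A.category_axioms
      g.B.category_axioms, goal_cases)
    case (2 u v \<beta>)
    then show ?case
      by (simp, intro psh_HomI)
         (simp_all add: Ob g.fob_in g.farr_in psh_Hom_component psh_Hom_natural)
  next
    case (4 u v w \<beta> \<gamma>)
    \<comment> \<open>The arrow map of \<open>precomp\<close> is \<open>undefined\<close> off the
      hom-sets, so it can be evaluated at the composite once the composite is known to lie in
      one.\<close>
    have "Cmp (psh U B) u v w \<gamma> \<beta> \<in> Hom (psh U B) u w" using 4 by (intro PB.Cmp_in)
    then show ?case using 4
      by (simp add: fun_eq_iff g.fob_in restrict_def)
  next
    case (3 u)
    have "Ide (psh U B) u \<in> Hom (psh U B) u u" using 3 by (intro PB.Ide_in)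
    then show ?case using 3
      by (simp add: fun_eq_iff g.fob_in restrict_def)
  qed (simp_all add: Ob, simp_all add: precomp_def)
qed

section \<open>The Yoneda embedding with coded hom-sets\<close>

lemma decode_code [simp]:
  "inj_on (\<iota> x y) (Hom A x y) \<Longrightarrow> h \<in> Hom A x y \<Longrightarrow> decode \<iota> A x y (\<iota> x y h) = h"
  by (simp add: decode_def the_inv_into_f_f)

lemma hom_setI: "h \<in> Hom A x y \<Longrightarrow> \<iota> x y h \<in> hom_set \<iota> A x y"
  by (simp add: hom_set_def)

lemma hom_setE:
  assumes "s \<in> hom_set \<iota> A x y" obtains h where "h \<in> Hom A x y" "s = \<iota> x y h"
  using assms by (auto simp: hom_set_def)

lemma small_hom_set:
  assumes U: "universe U" and small: "small U (Hom A x y)" and inj: "inj_on (\<iota> x y) (Hom A x y)"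
  shows "small U (hom_set \<iota> A x y)"
  using inj unfolding hom_set_def
  by (intro small_inj[OF U small inj_on_the_inv_into]) (auto simp: the_inv_into_f_f)

lemma yoneda_coded_fob [simp]:
  "x \<in> Ob A \<Longrightarrow> c \<in> Ob A \<Longrightarrow> fob (fob (yoneda_coded \<iota> A) x) c = hom_set \<iota> A c x"
  by (simp add: yoneda_coded_def)

lemma yoneda_coded_presheaf_arr [simp]:
  "\<lbrakk>inj_on (\<iota> c x) (Hom A c x); x \<in> Ob A; c \<in> Ob A; c' \<in> Ob A; h \<in> Hom A c' c; a \<in> Hom A c x\<rbrakk>
    \<Longrightarrow> farr (fob (yoneda_coded \<iota> A) x) c c' h (\<iota> c x a) = \<iota> c' x (Cmp A c' c x a h)"
  by (simp add: yoneda_coded_def hom_setI)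

lemma yoneda_coded_arr [simp]:
  "\<lbrakk>inj_on (\<iota> c x) (Hom A c x); x \<in> Ob A; y \<in> Ob A; c \<in> Ob A; g \<in> Hom A x y; a \<in> Hom A c x\<rbrakk>
    \<Longrightarrow> farr (yoneda_coded \<iota> A) x y g c (\<iota> c x a) = \<iota> c y (Cmp A c x y g a)"
  by (simp add: yoneda_coded_def hom_setI)

text \<open>An arbitrary injective code is allowed so that one proof yields both embeddings: that of
  \<open>D\<close>, coded by the identity, and that of \<open>psh U C\<close>, coded by
  \<open>nat_code\<close>. Once elements of a coded hom-set are written as codes of arrows, every
  equation reduces to the axioms of \<open>A\<close>.\<close>

lemma cfunctor_yoneda_coded:
  assumes U: "universe U" and "category A"
    and inj: "\<And>x y. x \<in> Ob A \<Longrightarrow> y \<in> Ob A \<Longrightarrow> inj_on (\<iota> x y) (Hom A x y)"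
    and small: "\<And>x y. x \<in> Ob A \<Longrightarrow> y \<in> Ob A \<Longrightarrow> small U (Hom A x y)"
  shows "cfunctor A (psh U A) (yoneda_coded \<iota> A)"
proof -
  interpret A: category A by fact
  let ?y = "yoneda_coded \<iota> A"
  have Ob: "fob ?y x \<in> Ob (psh U A)" if x: "x \<in> Ob A" for x
  proof (rule psh_ObI)
    fix c assume c: "c \<in> Ob A"
    then show "small U (fob (fob ?y x) c)"
      using small_hom_set[where \<iota> = \<iota>, OF U small inj] x by simp
  next
    fix c c' h assume c: "c \<in> Ob A" "c' \<in> Ob A" "h \<in> Hom A c' c"
    show "farr (fob ?y x) c c' h \<in> fob (fob ?y x) c \<rightarrow>\<^sub>E fob (fob ?y x) c'"
    proof (rule PiE_I)
      fix s assume "s \<in> fob (fob ?y x) c"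
      then show "farr (fob ?y x) c c' h s \<in> fob (fob ?y x) c'"
        using c x by (auto elim!: hom_setE simp: inj intro!: hom_setI A.Cmp_in)
    qed (use c x in \<open>simp add: yoneda_coded_def\<close>)
  next
    fix c s assume "c \<in> Ob A" "s \<in> fob (fob ?y x) c"
    then show "farr (fob ?y x) c c (Ide A c) s = s"
      using x by (auto elim!: hom_setE simp: inj A.Ide_in A.Cmp_Ide)
  next
    fix c c' c'' h k s
    assume "c \<in> Ob A" "c' \<in> Ob A" "c'' \<in> Ob A" "h \<in> Hom A c' c" "k \<in> Hom A c'' c'"
      "s \<in> fob (fob ?y x) c"
    then show "farr (fob ?y x) c c'' (Cmp A c'' c' c h k) s
        = farr (fob ?y x) c' c'' k (farr (fob ?y x) c c' h s)"
      using x by (auto elim!: hom_setE simp: inj A.Cmp_in A.Cmp_assoc)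
  qed (use x in \<open>simp_all add: yoneda_coded_def A.category_axioms\<close>)
  have arr: "farr ?y x y g \<in> Hom (psh U A) (fob ?y x) (fob ?y y)"
    if g: "x \<in> Ob A" "y \<in> Ob A" "g \<in> Hom A x y" for x y g
  proof (rule psh_HomI)
    fix c assume c: "c \<in> Ob A"
    show "farr ?y x y g c \<in> fob (fob ?y x) c \<rightarrow>\<^sub>E fob (fob ?y y) c"
    proof (rule PiE_I)
      fix s assume "s \<in> fob (fob ?y x) c"
      then show "farr ?y x y g c s \<in> fob (fob ?y y) c"
        using c g by (auto elim!: hom_setE simp: inj intro!: hom_setI A.Cmp_in)
    qed (use c g in \<open>simp add: yoneda_coded_def\<close>)
  next
    fix c c' h s assume "c \<in> Ob A" "c' \<in> Ob A" "h \<in> Hom A c' c" "s \<in> fob (fob ?y x) c"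
    then show "farr ?y x y g c' (farr (fob ?y x) c c' h s)
        = farr (fob ?y y) c c' h (farr ?y x y g c s)"
      using g by (auto elim!: hom_setE simp: inj A.Cmp_in A.Cmp_assoc)
  qed (use g Ob in \<open>simp_all add: yoneda_coded_def\<close>)
  interpret P: category "psh U A" by (rule category_psh) fact
  show ?thesis
  proof (intro cfunctor.intro cfunctor_axioms.intro category_psh A.category_axioms, goal_cases)
    case (3 x)
    show ?case
    proof (rule psh_Hom_eqI)
      show "farr ?y x x (Ide A x) \<in> Hom (psh U A) (fob ?y x) (fob ?y x)"
        "Ide (psh U A) (fob ?y x) \<in> Hom (psh U A) (fob ?y x) (fob ?y x)"
        using 3 arr A.Ide_in P.Ide_in Ob by blast+
      fix c s assume "c \<in> Ob A" "s \<in> fob (fob ?y x) c"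
      then show "farr ?y x x (Ide A x) c s = Ide (psh U A) (fob ?y x) c s"
        using 3 by (auto elim!: hom_setE simp: inj A.Ide_in A.Ide_Cmp hom_setI)
    qed
  next
    case (4 x y z h k)
    let ?C = "Cmp (psh U A) (fob ?y x) (fob ?y y) (fob ?y z) (farr ?y y z k) (farr ?y x y h)"
    show ?case
    proof (rule psh_Hom_eqI)
      show "farr ?y x z (Cmp A x y z k h) \<in> Hom (psh U A) (fob ?y x) (fob ?y z)"
        "?C \<in> Hom (psh U A) (fob ?y x) (fob ?y z)"
        using 4 by (auto intro!: arr P.Cmp_in Ob A.Cmp_in simp del: psh_Cmp)
      fix c s assume "c \<in> Ob A" "s \<in> fob (fob ?y x) c"
      then show "farr ?y x z (Cmp A x y z k h) c s = ?C c s"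
        using 4 by (auto elim!: hom_setE simp: inj A.Cmp_in A.Cmp_assoc hom_setI)
    qed
  qed (use Ob arr in auto, simp_all add: yoneda_coded_def)
qed

section \<open>Smallness of hom-sets\<close>

lemma essentially_smallE:
  fixes U :: "'s::zf_sets"
  assumes "essentially_small U A"
  obtains E :: "('s, 's) cat" and F G \<alpha>
  where "small_category U E" "cfunctor A E F" "cfunctor E A G"
    "nat_iso A A (id_functor A) (comp_functor A G F) \<alpha>"
  using assms unfolding essentially_small_def equivalent_def by blast

lemma small_category_Hom:
  assumes U: "universe U" and "small_category U E" "x \<in> Ob E" "y \<in> Ob E"
  shows "small U (Hom E x y)"
  by (rule small_inj[OF U, where g = "\<lambda>h. (x, y, h)"])
     (use assms in \<open>auto simp: small_category_def inj_on_def\<close>)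

text \<open>Identities embed the objects into the morphisms.\<close>

lemma small_category_Ob:
  assumes U: "universe U" and "small_category U E"
  shows "small U (Ob E)"
proof -
  interpret E: category E using assms(2) by (simp add: small_category_def)
  show ?thesis
    by (rule small_inj[OF U, where g = "\<lambda>x. (x, x, Ide E x)"])
       (use assms in \<open>auto simp: small_category_def inj_on_def E.Ide_in\<close>)
qed

text \<open>The functor \<open>F\<close> to the small category is faithful: conjugating the image of
  \<open>h\<close> under \<open>G\<close> after \<open>F\<close> by the isomorphisms
  \<open>\<alpha> x\<close> and \<open>\<alpha> y\<close> gives back \<open>h\<close>.\<close>

lemma essentially_small_Hom:
  fixes U :: "'s::zf_sets"
  assumes U: "universe U" and ess: "essentially_small U A" and x: "x \<in> Ob A" and y: "y \<in> Ob A"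
  shows "small U (Hom A x y)"
proof -
  obtain E :: "('s, 's) cat" and F G \<alpha> where E: "small_category U E" and F: "cfunctor A E F"
    and G: "cfunctor E A G"
    and \<alpha>: "nat_iso A A (id_functor A) (comp_functor A G F) \<alpha>"
    using essentially_smallE[OF ess] by metis
  interpret F: cfunctor A E F by fact
  interpret G: cfunctor E A G by fact
  interpret \<alpha>: nat_trans A A "id_functor A" "comp_functor A G F" \<alpha>
    using \<alpha> by (simp add: nat_iso_def)
  let ?y = "fob G (fob F y)"
  obtain k where k: "k \<in> Hom A ?y y" "Cmp A y ?y y k (\<alpha> y) = Ide A y"
    using \<alpha> y by (auto simp: nat_iso_def is_iso_def)
  have ay: "\<alpha> y \<in> Hom A y ?y" using \<alpha>.component_in[OF y] y by simp
  have gy: "?y \<in> Ob A" by (simp add: F.fob_in G.fob_in y)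
  have recover: "h = Cmp A x ?y y k (Cmp A x (fob G (fob F x)) ?y
      (farr G (fob F x) (fob F y) (farr F x y h)) (\<alpha> x))" if h: "h \<in> Hom A x y" for h
  proof -
    have "h = Cmp A x y y (Cmp A y ?y y k (\<alpha> y)) h" using F.A.Ide_Cmp x y h k(2) by simp
    also have "\<dots> = Cmp A x ?y y k (Cmp A x y ?y (\<alpha> y) h)"
      using F.A.Cmp_assoc[OF x y gy y h ay k(1)] by simp
    also have "Cmp A x y ?y (\<alpha> y) h = Cmp A x (fob G (fob F x)) ?y
        (farr G (fob F x) (fob F y) (farr F x y h)) (\<alpha> x)"
      using \<alpha>.naturality[OF x y h] x y h by simp
    finally show ?thesis .
  qed
  show ?thesis
  proof (rule small_inj[OF U small_category_Hom[OF U E F.fob_in[OF x] F.fob_in[OF y]]])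
    show "inj_on (farr F x y) (Hom A x y)" using recover by (metis inj_onI)
    show "farr F x y ` Hom A x y \<subseteq> Hom E (fob F x) (fob F y)" using F.farr_in x y by blast
  qed
qed

text \<open>A natural transformation is determined by its components at a set of representatives of the
  isomorphism classes of objects.\<close>

lemma essentially_small_psh_Hom:
  fixes U :: "'s::zf_sets" and A :: "('o, 'm) cat"
  assumes U: "universe U" and ess: "essentially_small U A"
    and u: "u \<in> Ob (psh U A)" and v: "v \<in> Ob (psh U A)"
  shows "small U (Hom (psh U A) u v)"
proof -
  obtain E :: "('s, 's) cat" and F G \<alpha> where E: "small_category U E" and F: "cfunctor A E F"
    and G: "cfunctor E A G"
    and \<alpha>: "nat_iso A A (id_functor A) (comp_functor A G F) \<alpha>"
    using essentially_smallE[OF ess] by metis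
  interpret F: cfunctor A E F by fact
  interpret G: cfunctor E A G by fact
  define r where "r \<beta> = (\<lambda>e\<in>Ob E. \<beta> (fob G e))" for \<beta> :: "'o \<Rightarrow> 's \<Rightarrow> 's"
  let ?P = "PiE (Ob E) (\<lambda>e. fob u (fob G e) \<rightarrow>\<^sub>E fob v (fob G e))"
  have "small U ?P"
    by (intro small_PiE U small_category_Ob[OF U E] psh_small[OF u] psh_small[OF v] G.fob_in)
  moreover have "inj_on r (Hom (psh U A) u v)"
  proof (rule inj_onI)
    fix \<beta> \<gamma> assume b: "\<beta> \<in> Hom (psh U A) u v" and c: "\<gamma> \<in> Hom (psh U A) u v" and "r \<beta> = r \<gamma>"
    then have eq: "\<beta> (fob G e) = \<gamma> (fob G e)" if "e \<in> Ob E" for e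
      using that unfolding r_def by (metis restrict_apply')
    show "\<beta> = \<gamma>"
    proof (rule psh_Hom_eqI[OF b c])
      fix x s assume x: "x \<in> Ob A" and s: "s \<in> fob u x"
      let ?x = "fob G (fob F x)"
      have gx: "?x \<in> Ob A" by (simp add: F.fob_in G.fob_in x)
      obtain k where i: "\<alpha> x \<in> Hom A x ?x" and k: "k \<in> Hom A ?x x"
        and ki: "Cmp A x ?x x k (\<alpha> x) = Ide A x"
        using \<alpha> x by (auto simp: nat_iso_def is_iso_def)
      \<comment> \<open>As \<open>k\<close> inverts \<open>\<alpha> x\<close>, restricting
        \<open>?t\<close> along \<open>\<alpha> x\<close> gives back \<open>s\<close>; naturality
        along \<open>\<alpha> x\<close> then carries agreement at \<open>?x\<close>, an object in
        the image of \<open>G\<close>, to agreement at \<open>x\<close>.\<close>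
      let ?t = "farr u x ?x k s"
      have t: "?t \<in> fob u ?x" using psh_farr_app[OF u x gx k s] .
      have "s = farr u ?x x (\<alpha> x) ?t"
        using psh_farr_Cmp[OF u x gx x k i s] psh_farr_Ide[OF u x s] ki by simp
      then show "\<beta> x s = \<gamma> x s"
        using psh_Hom_natural[OF b gx x i t] psh_Hom_natural[OF c gx x i t] eq[OF F.fob_in[OF x]]
        by simp
    qed
  qed
  moreover have "r ` Hom (psh U A) u v \<subseteq> ?P"
    unfolding r_def using psh_Hom_component G.fob_in by fastforce
  ultimately show ?thesis using small_inj[OF U] by blast
qed

lemma vapp_nat_code:
  assumes "is_set (Ob A)" "u \<in> Ob (psh U A)" "c \<in> Ob A" "s \<in> fob u c"
  shows "vapp (vapp (nat_code A u v \<alpha>) c) s = \<alpha> c s"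
  using assms small_is_set[OF psh_small[OF assms(2,3)]] by (simp add: nat_code_def)

text \<open>Applying a code twice with \<open>vapp\<close> recovers each value of each
  component.\<close>

lemma inj_on_nat_code:
  assumes "is_set (Ob A)" "u \<in> Ob (psh U A)"
  shows "inj_on (nat_code A u v) (Hom (psh U A) u v)"
  by (rule inj_onI, erule (1) psh_Hom_eqI) (metis vapp_nat_code[OF assms])

section \<open>The adjunction\<close>

text \<open>The hypothesis \<open>Ob_C\<close> is there for the codes: an essentially small category
  may have a proper class of objects, and a function on such a class is not a set.\<close>

locale presheaf_adjunction = f: cfunctor C D f
  for C D :: "('s::zf_sets, 's) cat" and f :: "('s, 's, 's, 's) ftor" +
  fixes U V :: 's
  assumes U: "universe U" and V: "universe V" and UV: "U \<in> elts V"
    and Ob_C: "is_set (Ob C)"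
    and C_small: "essentially_small U C" and D_small: "essentially_small U D"
begin

abbreviation H :: "'s \<Rightarrow> ('s, 's, 's) presheaf" where "H \<equiv> hom_along C D f"
abbreviation \<phi> where "\<phi> \<equiv> composite U V C D f"
abbreviation R where "R \<equiv> precomp U C D f"
abbreviation code where "code \<equiv> nat_code C"

lemma yoneda_D: "cfunctor D (psh U D) (yoneda D)"
  by (intro cfunctor_yoneda_coded U f.B.category_axioms essentially_small_Hom D_small) simp_all

lemma R: "cfunctor (psh U D) (psh U C) R"
  by (intro cfunctor_precomp f.cfunctor_axioms)

lemma inj_on_code: "u \<in> Ob (psh U C) \<Longrightarrow> inj_on (code u v) (Hom (psh U C) u v)"
  by (intro inj_on_nat_code Ob_C)

lemma small_V: "small U A \<Longrightarrow> small V A"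
  by (rule small_in_larger_universe[OF V UV])

text \<open>The hom-sets of \<open>psh U C\<close> are \<open>U\<close>-small, hence
  \<open>V\<close>-small, which is what places the representable presheaves in
  \<open>psh V (psh U C)\<close>.\<close>

lemma yoneda_psh_C: "cfunctor (psh U C) (psh V (psh U C)) (yoneda_psh U C)"
  by (intro cfunctor_yoneda_coded V category_psh f.A.category_axioms small_V
      essentially_small_psh_Hom U C_small inj_on_code)

lemma precomp_R: "cfunctor (psh V (psh U C)) (psh V (psh U D)) (precomp V (psh U D) (psh U C) R)"
  by (intro cfunctor_precomp R)

lemma precomp_yoneda_D: "cfunctor (psh V (psh U D)) (psh V D) (precomp V D (psh U D) (yoneda D))"
  by (intro cfunctor_precomp yoneda_D)

lemma composite_into_psh_V: "cfunctor (psh U C) (psh V D) \<phi>"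
  unfolding composite_def
  by (intro cfunctor_comp[OF _ precomp_yoneda_D] cfunctor_comp[OF yoneda_psh_C precomp_R])

section \<open>Values of the composite on objects and arrows\<close>

lemma hom_along_fob [simp]: "c \<in> Ob C \<Longrightarrow> fob (H d) c = Hom D (fob f c) d"
  by (simp add: hom_along_def)

lemma hom_along_farr [simp]:
  "c \<in> Ob C \<Longrightarrow> c' \<in> Ob C \<Longrightarrow> h \<in> Hom C c' c \<Longrightarrow> a \<in> Hom D (fob f c) d
    \<Longrightarrow> farr (H d) c c' h a = Cmp D (fob f c') (fob f c) d a (farr f c' c h)"
  by (simp add: hom_along_def)

lemma decode_id: "s \<in> Hom D x y \<Longrightarrow> decode (\<lambda>x y h. h) D x y s = s"
  using decode_code[of "\<lambda>x y h. h" x y D s] by simp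

lemma yoneda_D_Ob: "d \<in> Ob D \<Longrightarrow> fob (yoneda D) d \<in> Ob (psh U D)"
  by (rule cfunctor.fob_in[OF yoneda_D])

lemma yoneda_D_arr:
  "h \<in> Hom D d' d \<Longrightarrow> d' \<in> Ob D \<Longrightarrow> d \<in> Ob D \<Longrightarrow> farr (yoneda D) d' d h
    \<in> Hom (psh U D) (fob (yoneda D) d') (fob (yoneda D) d)"
  by (rule cfunctor.farr_in[OF yoneda_D])

text \<open>The composite evaluates Hom(-, v) at the left-hand side. It equals \<open>H d\<close>,
  rather than being just isomorphic to it, because the hom-sets of \<open>D\<close> are coded by the
  identity.\<close>

lemma R_yoneda:
  assumes "d \<in> Ob D" shows "fob R (fob (yoneda D) d) = H d"
proof -
  have "comp_functor (opp C) (fob (yoneda D) d) (opp_functor f) = H d"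
    using assms unfolding comp_functor_def hom_along_def
    by (auto simp: hom_set_def fun_eq_iff restrict_def restrict_arr_def f.fob_in f.farr_in
        yoneda_coded_def decode_id)
  then show ?thesis using yoneda_D_Ob[OF assms] by simp
qed

lemma H_Ob: "d \<in> Ob D \<Longrightarrow> H d \<in> Ob (psh U C)"
  using cfunctor.fob_in[OF R yoneda_D_Ob] R_yoneda by simp

text \<open>Unfolds both precompositions once, so that the values on objects and on arrows can be
  read off from the same equation.\<close>

lemma composite_presheaf:
  assumes v: "v \<in> Ob (psh U C)"
  shows "fob \<phi> v = comp_functor (opp D)
    (comp_functor (opp (psh U D)) (fob (yoneda_psh U C) v) (opp_functor R)) (opp_functor (yoneda D))"
proof -
  note y = cfunctor.fob_in[OF yoneda_psh_C v]
  show ?thesis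
    using precomp_simps(1)[OF y, of "psh U D" R]
      precomp_simps(1)[OF cfunctor.fob_in[OF precomp_R y], of D "yoneda D"] v
    by (simp add: composite_def del: precomp_simps)
qed

lemma composite_fob:
  "v \<in> Ob (psh U C) \<Longrightarrow> d \<in> Ob D
    \<Longrightarrow> fob (fob \<phi> v) d = hom_set code (psh U C) (H d) v"
  by (simp add: composite_presheaf R_yoneda H_Ob yoneda_D_Ob del: precomp_simps)

lemma psh_inclusion: "full_subcategory (psh U D) (psh V D)"
  by (intro psh_full_subcategory V UV f.B.category_axioms)

text \<open>The functor and presheaf axioms are inherited from \<open>psh V D\<close>; the size of
  the values is improved from \<open>V\<close> to \<open>U\<close> by the smallness of the hom-sets
  of \<open>psh U C\<close>.\<close>

lemma composite_cfunctor: "cfunctor (psh U C) (psh U D) \<phi>"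
proof (rule cfunctor_into_full_subcategory[OF psh_inclusion composite_into_psh_V])
  fix v assume v: "v \<in> Ob (psh U C)"
  have w: "fob \<phi> v \<in> Ob (psh V D)" by (rule cfunctor.fob_in[OF composite_into_psh_V v])
  show "fob \<phi> v \<in> Ob (psh U D)"
  proof (rule psh_ObI)
    fix d assume d: "d \<in> Ob D"
    then show "small U (fob (fob \<phi> v) d)"
      using small_hom_set[where \<iota> = code, OF U essentially_small_psh_Hom[OF U C_small]
        inj_on_code] H_Ob v
      by (simp add: composite_fob)
  qed (use psh_extensional[OF w] psh_farr_in[OF w] psh_farr_Ide[OF w] psh_farr_Cmp[OF w]
      f.B.category_axioms in auto)
qed

text \<open>Composing with \<open>h\<close> is a transformation from \<open>H d'\<close> to
  \<open>H d\<close>, and Hom(-, v) turns it into precomposition.\<close>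

lemma composite_presheaf_arr:
  assumes v: "v \<in> Ob (psh U C)" and d: "d \<in> Ob D" and d': "d' \<in> Ob D" and h: "h \<in> Hom D d' d"
    and \<alpha>: "\<alpha> \<in> Hom (psh U C) (H d) v"
  shows "farr (fob \<phi> v) d d' h (code (H d) v \<alpha>)
    = code (H d') v (\<lambda>c\<in>Ob C. \<lambda>a\<in>Hom D (fob f c) d'. \<alpha> c (Cmp D (fob f c) d' d h a))"
proof -
  have Rh: "farr R (fob (yoneda D) d') (fob (yoneda D) d) (farr (yoneda D) d' d h)
      \<in> Hom (psh U C) (H d') (H d)"
    using cfunctor.farr_in[OF R yoneda_D_Ob[OF d'] yoneda_D_Ob[OF d] yoneda_D_arr[OF h d' d]]
    by (simp only: R_yoneda d d')
  have Rh_eq: "farr R (fob (yoneda D) d') (fob (yoneda D) d) (farr (yoneda D) d' d h)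
      = (\<lambda>c\<in>Ob C. farr (yoneda D) d' d h (fob f c))"
    using yoneda_D_Ob d d' yoneda_D_arr[OF h d' d] by simp
  have "farr (fob \<phi> v) d d' h (code (H d) v \<alpha>)
      = farr (fob (yoneda_psh U C) v) (H d) (H d')
          (farr R (fob (yoneda D) d') (fob (yoneda D) d) (farr (yoneda D) d' d h))
          (code (H d) v \<alpha>)"
    using v d d' h yoneda_D_arr[OF h d' d]
    by (simp add: composite_presheaf yoneda_D_Ob R_yoneda del: precomp_simps)
  also have "\<dots> = code (H d') v (Cmp (psh U C) (H d') (H d) v \<alpha>
      (farr R (fob (yoneda D) d') (fob (yoneda D) d) (farr (yoneda D) d' d h)))"
    by (rule yoneda_coded_presheaf_arr) (use Rh v d d' H_Ob \<alpha> inj_on_code in auto)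
  also have "Cmp (psh U C) (H d') (H d) v \<alpha>
      (farr R (fob (yoneda D) d') (fob (yoneda D) d) (farr (yoneda D) d' d h))
    = (\<lambda>c\<in>Ob C. \<lambda>a\<in>Hom D (fob f c) d'. \<alpha> c (Cmp D (fob f c) d' d h a))"
    unfolding Rh_eq using d d' h
    by (auto simp: fun_eq_iff restrict_def f.fob_in yoneda_coded_def hom_set_def decode_id)
  finally show ?thesis .
qed

text \<open>Serves to evaluate the counit on a restricted transformation, since
  \<open>counit_map_apply\<close> asks for a genuine natural transformation.\<close>

lemma precompose_in:
  assumes v: "v \<in> Ob (psh U C)" and d: "d \<in> Ob D" and d': "d' \<in> Ob D" and h: "h \<in> Hom D d' d"
    and \<alpha>: "\<alpha> \<in> Hom (psh U C) (H d) v"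
  shows "(\<lambda>c\<in>Ob C. \<lambda>a\<in>Hom D (fob f c) d'. \<alpha> c (Cmp D (fob f c) d' d h a))
    \<in> Hom (psh U C) (H d') v" (is "?\<alpha> \<in> _")
proof (rule psh_HomI[OF H_Ob[OF d'] v])
  fix c assume "c \<in> Ob C"
  then show "?\<alpha> c \<in> fob (H d') c \<rightarrow>\<^sub>E fob v c"
    using psh_Hom_app[OF \<alpha>] d d' h by (auto simp: f.B.Cmp_in f.fob_in)
next
  fix c c' k t assume "c \<in> Ob C" "c' \<in> Ob C" "k \<in> Hom C c' c" "t \<in> fob (H d') c"
  then show "?\<alpha> c' (farr (H d') c c' k t) = farr v c c' k (?\<alpha> c t)"
    using psh_Hom_natural[OF \<alpha>, symmetric] d d' h
    by (simp add: f.B.Cmp_in f.fob_in f.farr_in f.B.Cmp_assoc)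
qed simp

lemma composite_arr:
  assumes v: "v \<in> Ob (psh U C)" and w: "w \<in> Ob (psh U C)" and \<beta>: "\<beta> \<in> Hom (psh U C) v w"
    and d: "d \<in> Ob D" and \<alpha>: "\<alpha> \<in> Hom (psh U C) (H d) v"
  shows "farr \<phi> v w \<beta> d (code (H d) v \<alpha>)
    = code (H d) w (\<lambda>c\<in>Ob C. \<lambda>a\<in>Hom D (fob f c) d. \<beta> c (\<alpha> c a))"
proof -
  let ?y = "yoneda_psh U C" and ?f = "precomp V (psh U D) (psh U C) R"
  note y = cfunctor.fob_in[OF yoneda_psh_C v] cfunctor.fob_in[OF yoneda_psh_C w]
    cfunctor.farr_in[OF yoneda_psh_C v w \<beta>]
  have "farr \<phi> v w \<beta> d = farr ?f (fob ?y v) (fob ?y w) (farr ?y v w \<beta>) (fob (yoneda D) d)"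
    using v w \<beta> d cfunctor.fob_in[OF precomp_R y(1)] cfunctor.fob_in[OF precomp_R y(2)]
      cfunctor.farr_in[OF precomp_R y]
    by (simp add: composite_def del: precomp_simps(1) precomp_simps(2)[where A = "psh U D"])
  \<comment> \<open>A precomposed transformation has at \<open>fob (yoneda D) d\<close> the
    component at the image of that object under \<open>R\<close>, which is
    \<open>H d\<close>.\<close>
  also have "\<dots> = farr ?y v w \<beta> (H d)"
    using y yoneda_D_Ob[OF d] R_yoneda[OF d] by (simp del: precomp_simps(1))
  finally have "farr \<phi> v w \<beta> d (code (H d) v \<alpha>) = farr ?y v w \<beta> (H d) (code (H d) v \<alpha>)"
    by simp
  also have "\<dots> = code (H d) w (Cmp (psh U C) (H d) v w \<beta> \<alpha>)"
    using inj_on_code H_Ob d v w \<alpha> \<beta> by (intro yoneda_coded_arr) auto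
  also have "Cmp (psh U C) (H d) v w \<beta> \<alpha>
      = (\<lambda>c\<in>Ob C. \<lambda>a\<in>Hom D (fob f c) d. \<beta> c (\<alpha> c a))"
    by (simp add: fun_eq_iff restrict_def)
  finally show ?thesis .
qed

lemma composite_elem:
  assumes "v \<in> Ob (psh U C)" "d \<in> Ob D" "s \<in> fob (fob \<phi> v) d"
  obtains \<alpha> where "\<alpha> \<in> Hom (psh U C) (H d) v" "s = code (H d) v \<alpha>"
  using assms by (auto simp: composite_fob elim: hom_setE)

lemma composite_elemI:
  "v \<in> Ob (psh U C) \<Longrightarrow> d \<in> Ob D \<Longrightarrow> \<alpha> \<in> Hom (psh U C) (H d) v
    \<Longrightarrow> code (H d) v \<alpha> \<in> fob (fob \<phi> v) d"
  by (simp add: composite_fob hom_setI)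

section \<open>The unit: transposes of elements\<close>

lemma R_Ob: "u \<in> Ob (psh U D) \<Longrightarrow> fob R u \<in> Ob (psh U C)"
  by (rule cfunctor.fob_in[OF R])

lemma \<phi>_Ob: "v \<in> Ob (psh U C) \<Longrightarrow> fob \<phi> v \<in> Ob (psh U D)"
  by (rule cfunctor.fob_in[OF composite_cfunctor])

text \<open>With \<open>precomp_simps\<close> removed from the simplifier, \<open>fob R u\<close>
  keeps the form in which facts about it are stated; this rule and the next then compute its
  values.\<close>

lemma R_fob: "u \<in> Ob (psh U D) \<Longrightarrow> c \<in> Ob C \<Longrightarrow> fob (fob R u) c = fob u (fob f c)"
  by simp

lemma R_farr: "u \<in> Ob (psh U D) \<Longrightarrow> c \<in> Ob C \<Longrightarrow> c' \<in> Ob C \<Longrightarrow> h \<in> Hom C c' c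
    \<Longrightarrow> farr (fob R u) c c' h = farr u (fob f c) (fob f c') (farr f c' c h)"
  by simp

text \<open>The Yoneda lemma turns \<open>x\<close> into a transformation from
  \<open>fob (yoneda D) d\<close> to \<open>u\<close>; this is its image under
  \<open>R\<close>.\<close>

definition yoneda_transpose :: "('s, 's, 's) presheaf \<Rightarrow> 's \<Rightarrow> 's \<Rightarrow> 's \<Rightarrow> 's \<Rightarrow> 's" where
  "yoneda_transpose u d x = (\<lambda>c\<in>Ob C. \<lambda>a\<in>Hom D (fob f c) d. farr u d (fob f c) a x)"

text \<open>Naturality is functoriality of \<open>u\<close> at the composite of \<open>a\<close>
  with the image of \<open>h\<close> under \<open>f\<close>.\<close>

lemma yoneda_transpose_in:
  assumes u: "u \<in> Ob (psh U D)" and d: "d \<in> Ob D" and x: "x \<in> fob u d"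
  shows "yoneda_transpose u d x \<in> Hom (psh U C) (H d) (fob R u)"
proof (rule psh_HomI[OF H_Ob[OF d] R_Ob[OF u]])
  fix c assume "c \<in> Ob C"
  then show "yoneda_transpose u d x c \<in> fob (H d) c \<rightarrow>\<^sub>E fob (fob R u) c"
    using psh_farr_app[OF u d f.fob_in _ x]
    by (auto simp: yoneda_transpose_def R_fob u simp del: precomp_simps)
next
  fix c c' h a assume "c \<in> Ob C" "c' \<in> Ob C" "h \<in> Hom C c' c" "a \<in> fob (H d) c"
  then show "yoneda_transpose u d x c' (farr (H d) c c' h a)
      = farr (fob R u) c c' h (yoneda_transpose u d x c a)"
    using psh_farr_Cmp[OF u d f.fob_in f.fob_in _ f.farr_in x]
    by (simp add: yoneda_transpose_def R_farr u d f.B.Cmp_in f.fob_in f.farr_in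
        del: precomp_simps)
qed (simp add: yoneda_transpose_def)

lemma unit_map_apply:
  "u \<in> Ob (psh U D) \<Longrightarrow> d \<in> Ob D \<Longrightarrow> x \<in> fob u d
    \<Longrightarrow> unit_map U C D f u d x = code (H d) (fob R u) (yoneda_transpose u d x)"
  by (simp add: unit_map_def yoneda_transpose_def)

lemma unit_map_in:
  assumes u: "u \<in> Ob (psh U D)"
  shows "unit_map U C D f u \<in> Hom (psh U D) u (fob \<phi> (fob R u))"
proof (rule psh_HomI[OF u \<phi>_Ob[OF R_Ob[OF u]]])
  fix d assume d: "d \<in> Ob D"
  show "unit_map U C D f u d \<in> fob u d \<rightarrow>\<^sub>E fob (fob \<phi> (fob R u)) d"
  proof (rule PiE_I)
    fix x assume "x \<in> fob u d"
    then show "unit_map U C D f u d x \<in> fob (fob \<phi> (fob R u)) d"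
      using unit_map_apply[OF u d] composite_elemI[OF R_Ob[OF u] d] yoneda_transpose_in[OF u d]
      by simp
  qed (use u d in \<open>simp add: unit_map_def\<close>)
next
  fix d d' h x assume d: "d \<in> Ob D" and d': "d' \<in> Ob D" and h: "h \<in> Hom D d' d"
    and x: "x \<in> fob u d"
  \<comment> \<open>Both sides send \<open>a\<close> to the value at \<open>x\<close> of
    \<open>u\<close> on the composite of \<open>h\<close> and \<open>a\<close>.\<close>
  have "yoneda_transpose u d' (farr u d d' h x)
      = (\<lambda>c\<in>Ob C. \<lambda>a\<in>Hom D (fob f c) d'. yoneda_transpose u d x c (Cmp D (fob f c) d' d h a))"
    using psh_farr_Cmp[OF u d d' f.fob_in h _ x] h d d'
    by (simp add: yoneda_transpose_def fun_eq_iff restrict_def f.fob_in f.B.Cmp_in)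
  then show "unit_map U C D f u d' (farr u d d' h x)
      = farr (fob \<phi> (fob R u)) d d' h (unit_map U C D f u d x)"
    using unit_map_apply[OF u d x] unit_map_apply[OF u d' psh_farr_app[OF u d d' h x]]
      composite_presheaf_arr[OF R_Ob[OF u] d d' h yoneda_transpose_in[OF u d x]]
    by (simp del: precomp_simps)
qed (use u in \<open>simp add: unit_map_def\<close>)

section \<open>The counit: evaluation at identities\<close>

lemma counit_map_apply:
  assumes v: "v \<in> Ob (psh U C)" and c: "c \<in> Ob C"
    and \<alpha>: "\<alpha> \<in> Hom (psh U C) (H (fob f c)) v"
  shows "counit_map U C D f v c (code (H (fob f c)) v \<alpha>) = \<alpha> c (Ide D (fob f c))"
  using assms hom_setI[where \<iota> = code, OF \<alpha>]
    vapp_nat_code[OF Ob_C H_Ob[OF f.fob_in[OF c]] c, of "Ide D (fob f c)" v \<alpha>]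
  by (simp add: counit_map_def f.fob_in f.B.Ide_in)

lemma counit_map_in:
  assumes v: "v \<in> Ob (psh U C)"
  shows "counit_map U C D f v \<in> Hom (psh U C) (fob R (fob \<phi> v)) v"
proof (rule psh_HomI[OF R_Ob[OF \<phi>_Ob[OF v]] v])
  fix c assume c: "c \<in> Ob C"
  have fc: "fob f c \<in> Ob D" using c by (rule f.fob_in)
  show "counit_map U C D f v c \<in> fob (fob R (fob \<phi> v)) c \<rightarrow>\<^sub>E fob v c"
  proof (rule PiE_I)
    fix s assume "s \<in> fob (fob R (fob \<phi> v)) c"
    then have "s \<in> fob (fob \<phi> v) (fob f c)" using R_fob[OF \<phi>_Ob[OF v] c] by simp
    then obtain \<alpha> where a: "\<alpha> \<in> Hom (psh U C) (H (fob f c)) v" "s = code (H (fob f c)) v \<alpha>"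
      by (rule composite_elem[OF v fc])
    then show "counit_map U C D f v c s \<in> fob v c"
      using counit_map_apply[OF v c a(1)] psh_Hom_app[OF a(1) c] c fc by (simp add: f.B.Ide_in)
  next
    fix s assume "s \<notin> fob (fob R (fob \<phi> v)) c"
    then show "counit_map U C D f v c s = undefined"
      using v c R_fob[OF \<phi>_Ob[OF v] c] composite_fob[OF v fc]
      by (simp add: counit_map_def del: precomp_simps)
  qed
next
  fix c c' h s assume c: "c \<in> Ob C" and c': "c' \<in> Ob C" and h: "h \<in> Hom C c' c"
    and "s \<in> fob (fob R (fob \<phi> v)) c"
  then have s: "s \<in> fob (fob \<phi> v) (fob f c)" using R_fob[OF \<phi>_Ob[OF v] c] by simp
  have fc: "fob f c \<in> Ob D" "fob f c' \<in> Ob D" using c c' f.fob_in by auto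
  obtain \<alpha> where a: "\<alpha> \<in> Hom (psh U C) (H (fob f c)) v" "s = code (H (fob f c)) v \<alpha>"
    using s by (rule composite_elem[OF v fc(1)])
  let ?h = "farr f c' c h"
  have fh: "?h \<in> Hom D (fob f c') (fob f c)" using c' c h by (rule f.farr_in)
  have eq: "farr (fob \<phi> v) (fob f c) (fob f c') ?h s = code (H (fob f c')) v
      (\<lambda>b\<in>Ob C. \<lambda>a\<in>Hom D (fob f b) (fob f c'). \<alpha> b (Cmp D (fob f b) (fob f c') (fob f c) ?h a))"
    (is "_ = code _ v ?\<alpha>")
    using composite_presheaf_arr[OF v fc fh a(1)] a(2) by simp
  note in_N = precompose_in[OF v fc fh a(1)]
  \<comment> \<open>Both sides equal \<open>\<alpha> c' ?h\<close>: one by evaluating the restricted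
    transformation at the identity of \<open>fob f c'\<close>, the other by naturality of \<alpha>
    at the identity of \<open>fob f c\<close>.\<close>
  have "counit_map U C D f v c' (farr (fob R (fob \<phi> v)) c c' h s) = \<alpha> c' ?h"
    using counit_map_apply[OF v c' in_N] eq c' c h fc fh R_farr[OF \<phi>_Ob[OF v] c c' h]
    by (simp add: f.B.Ide_in f.B.Cmp_Ide del: precomp_simps)
  also have "\<dots> = farr v c c' h (\<alpha> c (Ide D (fob f c)))"
    using psh_Hom_natural[OF a(1) c c' h, of "Ide D (fob f c)"] c c' h fc fh
    by (simp add: f.B.Ide_in f.B.Ide_Cmp)
  also have "\<dots> = farr v c c' h (counit_map U C D f v c s)"
    using counit_map_apply[OF v c a(1)] a(2) by simp
  finally show "counit_map U C D f v c' (farr (fob R (fob \<phi> v)) c c' h s)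
      = farr v c c' h (counit_map U C D f v c s)" .
qed (use v in \<open>simp add: counit_map_def\<close>)

section \<open>Naturality in the presheaf and the triangle identities\<close>

lemma R_arr:
  "u \<in> Ob (psh U D) \<Longrightarrow> w \<in> Ob (psh U D) \<Longrightarrow> \<beta> \<in> Hom (psh U D) u w
    \<Longrightarrow> farr R u w \<beta> = (\<lambda>c\<in>Ob C. \<beta> (fob f c))"
  by simp

lemma R_arr_in:
  "u \<in> Ob (psh U D) \<Longrightarrow> w \<in> Ob (psh U D) \<Longrightarrow> \<beta> \<in> Hom (psh U D) u w
    \<Longrightarrow> farr R u w \<beta> \<in> Hom (psh U C) (fob R u) (fob R w)"
  by (rule cfunctor.farr_in[OF R])

lemma \<phi>_arr_in:
  "v \<in> Ob (psh U C) \<Longrightarrow> w \<in> Ob (psh U C) \<Longrightarrow> \<beta> \<in> Hom (psh U C) v w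
    \<Longrightarrow> farr \<phi> v w \<beta> \<in> Hom (psh U D) (fob \<phi> v) (fob \<phi> w)"
  by (rule cfunctor.farr_in[OF composite_cfunctor])

text \<open>Comes down to naturality of \<beta> along the arrows \<open>a\<close> from
  \<open>fob f c\<close> to \<open>d\<close>.\<close>

lemma unit_map_natural:
  assumes u: "u \<in> Ob (psh U D)" and w: "w \<in> Ob (psh U D)" and \<beta>: "\<beta> \<in> Hom (psh U D) u w"
    and d: "d \<in> Ob D" and x: "x \<in> fob u d"
  shows "unit_map U C D f w d (\<beta> d x)
    = farr \<phi> (fob R u) (fob R w) (farr R u w \<beta>) d (unit_map U C D f u d x)"
proof -
  have "yoneda_transpose w d (\<beta> d x)
      = (\<lambda>c\<in>Ob C. \<lambda>a\<in>Hom D (fob f c) d. farr R u w \<beta> c (yoneda_transpose u d x c a))"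
    using psh_Hom_natural[OF \<beta> d f.fob_in _ x]
    by (simp add: yoneda_transpose_def fun_eq_iff restrict_def R_arr[OF u w \<beta>] del: precomp_simps)
  then show ?thesis
    using composite_arr[OF R_Ob[OF u] R_Ob[OF w] R_arr_in[OF u w \<beta>] d yoneda_transpose_in[OF u d x]]
      unit_map_apply[OF u d x] unit_map_apply[OF w d psh_Hom_app[OF \<beta> d x]]
    by (simp del: precomp_simps)
qed

lemma postcompose_in:
  assumes "\<alpha> \<in> Hom (psh U C) (H d) v" "\<beta> \<in> Hom (psh U C) v w"
  shows "(\<lambda>c\<in>Ob C. \<lambda>a\<in>Hom D (fob f c) d. \<beta> c (\<alpha> c a)) \<in> Hom (psh U C) (H d) w"
proof -
  interpret P: category "psh U C" by (rule category_psh) (rule f.A.category_axioms)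
  have "Cmp (psh U C) (H d) v w \<beta> \<alpha> \<in> Hom (psh U C) (H d) w"
    using assms psh_Hom_dom psh_Hom_cod by (intro P.Cmp_in) blast+
  moreover have "Cmp (psh U C) (H d) v w \<beta> \<alpha>
      = (\<lambda>c\<in>Ob C. \<lambda>a\<in>Hom D (fob f c) d. \<beta> c (\<alpha> c a))"
    by (simp add: fun_eq_iff restrict_def)
  ultimately show ?thesis by simp
qed

text \<open>Evaluation at an identity commutes with postcomposition by \<beta>.\<close>

lemma counit_map_natural:
  assumes v: "v \<in> Ob (psh U C)" and w: "w \<in> Ob (psh U C)" and \<beta>: "\<beta> \<in> Hom (psh U C) v w"
    and c: "c \<in> Ob C" and s: "s \<in> fob (fob \<phi> v) (fob f c)"
  shows "counit_map U C D f w c (farr \<phi> v w \<beta> (fob f c) s) = \<beta> c (counit_map U C D f v c s)"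
proof -
  have fc: "fob f c \<in> Ob D" using c by (rule f.fob_in)
  obtain \<alpha> where a: "\<alpha> \<in> Hom (psh U C) (H (fob f c)) v" "s = code (H (fob f c)) v \<alpha>"
    using s by (rule composite_elem[OF v fc])
  show ?thesis
    using composite_arr[OF v w \<beta> fc a(1)] counit_map_apply[OF v c a(1)]
      counit_map_apply[OF w c postcompose_in[OF a(1) \<beta>]] a(2) c fc
    by (simp add: f.B.Ide_in)
qed

text \<open>First triangle identity at an element: the transpose of \<open>x\<close>, evaluated at
  the identity of \<open>fob f c\<close>, is \<open>u\<close> of that identity applied to
  \<open>x\<close>.\<close>

lemma counit_unit:
  assumes u: "u \<in> Ob (psh U D)" and c: "c \<in> Ob C" and x: "x \<in> fob u (fob f c)"
  shows "counit_map U C D f (fob R u) c (unit_map U C D f u (fob f c) x) = x"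
proof -
  have fc: "fob f c \<in> Ob D" using c by (rule f.fob_in)
  show ?thesis
    using unit_map_apply[OF u fc x] counit_map_apply[OF R_Ob[OF u] c yoneda_transpose_in[OF u fc x]]
      psh_farr_Ide[OF u fc x] c fc
    by (simp add: yoneda_transpose_def f.B.Ide_in del: precomp_simps)
qed

text \<open>Second triangle identity at an element. The element codes some \<alpha>; its transpose
  has at \<open>b\<close> the code of \<alpha> restricted along \<open>b\<close>, and evaluating
  this at the identity of \<open>fob f c\<close> gives \<open>\<alpha> c b\<close>.\<close>

lemma unit_counit:
  assumes v: "v \<in> Ob (psh U C)" and d: "d \<in> Ob D" and s: "s \<in> fob (fob \<phi> v) d"
  shows "farr \<phi> (fob R (fob \<phi> v)) v (counit_map U C D f v) d (unit_map U C D f (fob \<phi> v) d s) = s"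
proof -
  obtain \<alpha> where a: "\<alpha> \<in> Hom (psh U C) (H d) v" and s_eq: "s = code (H d) v \<alpha>"
    using s by (rule composite_elem[OF v d])
  have "farr \<phi> (fob R (fob \<phi> v)) v (counit_map U C D f v) d (unit_map U C D f (fob \<phi> v) d s)
      = code (H d) v (\<lambda>c\<in>Ob C. \<lambda>a\<in>Hom D (fob f c) d.
          counit_map U C D f v c (yoneda_transpose (fob \<phi> v) d s c a))"
    unfolding unit_map_apply[OF \<phi>_Ob[OF v] d s]
    by (intro composite_arr R_Ob \<phi>_Ob v counit_map_in d yoneda_transpose_in s)
  also have "(\<lambda>c\<in>Ob C. \<lambda>a\<in>Hom D (fob f c) d.
      counit_map U C D f v c (yoneda_transpose (fob \<phi> v) d s c a)) = \<alpha>"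
  proof (rule psh_Hom_eqI[OF _ a])
    show "(\<lambda>c\<in>Ob C. \<lambda>a\<in>Hom D (fob f c) d.
        counit_map U C D f v c (yoneda_transpose (fob \<phi> v) d s c a)) \<in> Hom (psh U C) (H d) v"
      by (rule postcompose_in[OF yoneda_transpose_in[OF \<phi>_Ob[OF v] d s] counit_map_in[OF v]])
    fix c b assume c: "c \<in> Ob C" and "b \<in> fob (H d) c"
    then have b: "b \<in> Hom D (fob f c) d" by simp
    have fc: "fob f c \<in> Ob D" using c by (rule f.fob_in)
    let ?\<alpha> = "\<lambda>c'\<in>Ob C. \<lambda>a\<in>Hom D (fob f c') (fob f c). \<alpha> c' (Cmp D (fob f c') (fob f c) d b a)"
    have "counit_map U C D f v c (yoneda_transpose (fob \<phi> v) d s c b)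
        = counit_map U C D f v c (code (H (fob f c)) v ?\<alpha>)"
      using composite_presheaf_arr[OF v d fc b a] s_eq c b by (simp add: yoneda_transpose_def)
    also have "\<dots> = ?\<alpha> c (Ide D (fob f c))"
      by (rule counit_map_apply[OF v c precompose_in[OF v d fc b a]])
    also have "\<dots> = \<alpha> c b"
      using c fc d b by (simp add: f.B.Ide_in f.B.Cmp_Ide)
    finally show "(\<lambda>c\<in>Ob C. \<lambda>a\<in>Hom D (fob f c) d.
        counit_map U C D f v c (yoneda_transpose (fob \<phi> v) d s c a)) c b = \<alpha> c b"
      using c b by simp
  qed
  finally show ?thesis using s_eq by simp
qed

section \<open>Assembly of the adjunction\<close>

lemma psh_R_\<phi>: "cfunctor (psh U D) (psh U D) (comp_functor (psh U D) \<phi> R)"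
  and psh_\<phi>_R: "cfunctor (psh U C) (psh U C) (comp_functor (psh U C) R \<phi>)"
  by (rule cfunctor_comp[OF R composite_cfunctor], rule cfunctor_comp[OF composite_cfunctor R])

lemma unit_nat_trans:
  "nat_trans (psh U D) (psh U D) (id_functor (psh U D)) (comp_functor (psh U D) \<phi> R)
    (unit_map U C D f)"
proof (intro nat_trans.intro nat_trans_axioms.intro psh_R_\<phi> cfunctor_id category_psh
    f.B.category_axioms, goal_cases)
  case (1 u)
  then show ?case using unit_map_in by (simp del: precomp_simps)
next
  case (2 u w \<beta>)
  note \<beta> = 2(3) and uw = 2(1,2)
  show ?case
    using unit_map_natural[OF uw \<beta>] psh_Hom_app[OF \<beta>] uw \<beta>
    by (auto simp: fun_eq_iff restrict_def simp del: precomp_simps)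
next
  case 3
  then show ?case by (simp add: unit_map_def)
qed

lemma counit_nat_trans:
  "nat_trans (psh U C) (psh U C) (comp_functor (psh U C) R \<phi>) (id_functor (psh U C))
    (counit_map U C D f)"
proof (intro nat_trans.intro nat_trans_axioms.intro psh_\<phi>_R cfunctor_id category_psh
    f.A.category_axioms, goal_cases)
  case (1 v)
  then show ?case using counit_map_in by (simp del: precomp_simps)
next
  case (2 v w \<beta>)
  note \<beta> = 2(3) and vw = 2(1,2)
  show ?case
    using counit_map_natural[OF vw \<beta>] vw \<beta> \<phi>_arr_in[OF vw \<beta>]
    by (auto simp: fun_eq_iff restrict_def R_fob \<phi>_Ob R_arr simp del: precomp_simps)
next
  case 3
  then show ?case by (simp add: counit_map_def)
qed

lemma composite_right_adjoint:
  "adjunction (psh U D) (psh U C) R \<phi> (unit_map U C D f) (counit_map U C D f)"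
proof (intro adjunction.intro adjunction_axioms.intro R composite_cfunctor unit_nat_trans
    counit_nat_trans, goal_cases)
  case (1 u)
  then show ?case
    using counit_unit[OF 1] unit_map_in[OF 1] \<phi>_Ob[OF R_Ob[OF 1]]
    by (auto simp: fun_eq_iff restrict_def R_fob R_arr simp del: precomp_simps)
next
  case (2 v)
  then show ?case
    using unit_counit[OF 2] by (auto simp: fun_eq_iff restrict_def simp del: precomp_simps)
qed

end

theorem proposition2p1:
  fixes U V :: "'s::sets_with_universes"
    and C D :: "('s, 's) cat"
    and f :: "('s, 's, 's, 's) ftor"
  assumes "universe U" and "universe V" and "elts U \<noteq> {}" and "U \<in> elts V"
    and "category C" and "is_set (Ob C)" and "essentially_small U C"
    and "category D" and "is_set (Ob D)" and "essentially_small U D"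
    and "cfunctor C D f"
  shows "cfunctor D (psh U D) (yoneda D) \<and>
         cfunctor (psh U D) (psh U C) (precomp U C D f) \<and>
         cfunctor (psh U C) (psh V (psh U C)) (yoneda_psh U C) \<and>
         cfunctor (psh V (psh U C)) (psh V (psh U D))
           (precomp V (psh U D) (psh U C) (precomp U C D f)) \<and>
         cfunctor (psh V (psh U D)) (psh V D) (precomp V D (psh U D) (yoneda D)) \<and>
         (\<forall>v\<in>Ob (psh U C). \<forall>d\<in>Ob D.
           fob (fob (composite U V C D f) v) d
             = hom_set (nat_code C) (psh U C) (hom_along C D f d) v) \<and>
         full_subcategory (psh U D) (psh V D) \<and>
         (\<exists>\<phi>. cfunctor (psh U C) (psh U D) \<phi> \<and>
           comp_functor (psh U C) (id_functor (psh U D)) \<phi> = composite U V C D f \<and>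
           adjunction (psh U D) (psh U C) (precomp U C D f) \<phi>
             (unit_map U C D f) (counit_map U C D f))"
proof -
  interpret f: cfunctor C D f by fact
  interpret presheaf_adjunction C D f U V
    by unfold_locales (use assms in auto)
  \<comment> \<open>The inclusion of \<open>psh U D\<close> in \<open>psh V D\<close> is the
    identity on objects and arrows, hence given by \<open>id_functor (psh U D)\<close>; the witness
    for \<phi> is the composite itself.\<close>
  have "comp_functor (psh U C) (id_functor (psh U D)) \<phi> = \<phi>"
    by (rule comp_id_functor[OF composite_cfunctor])
  then show ?thesis
    using yoneda_D R yoneda_psh_C precomp_R precomp_yoneda_D composite_fob psh_inclusion
      composite_cfunctor composite_right_adjoint by blast
qed

end
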